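(* Let $n \ge 1$ and let $T \subset \mathbb{Z}^n$ be a tile. Then there exists $d \ge n$ such that $T$ tiles $\mathbb{Z}^d$.
   Context: A tile is a finite non-empty subset of $\mathbb{Z}^n$ for some $n$. For $d \ge n$, regard $T$ as a subset of $\mathbb{Z}^d$ via the embedding $x \mapsto (x,0,\dots,0)$. A copy of $T$ in $\mathbb{Z}^d$ is a subset of $\mathbb{Z}^d$ isometric to $T$ (with respect to the Euclidean metric). We say $T$ tiles $\mathbb{Z}^d$ if $\mathbb{Z}^d$ can be partitioned into copies of $T$. *)

theory Defs
  imports Complex_Main
begin

text \<open>Points of Z^d are represented as functions nat => int vanishing at all
coordinates i >= d. Then Z^n is literally a subset of Z^d for d >= n, which is
exactly the embedding x |-> (x,0,...,0).\<close>

definition zspace :: "nat \<Rightarrow> (nat \<Rightarrow> int) set" where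
  "zspace d = {x. \<forall>i\<ge>d. x i = 0}"

definition edist :: "nat \<Rightarrow> (nat \<Rightarrow> int) \<Rightarrow> (nat \<Rightarrow> int) \<Rightarrow> real" where
  "edist d x y = sqrt (\<Sum>i<d. (real_of_int (x i - y i))\<^sup>2)"

definition is_tile :: "nat \<Rightarrow> (nat \<Rightarrow> int) set \<Rightarrow> bool" where
  "is_tile n T \<longleftrightarrow> finite T \<and> T \<noteq> {} \<and> T \<subseteq> zspace n"

definition is_copy :: "nat \<Rightarrow> (nat \<Rightarrow> int) set \<Rightarrow> (nat \<Rightarrow> int) set \<Rightarrow> bool" where
  "is_copy d T S \<longleftrightarrow> S \<subseteq> zspace d \<and>
     (\<exists>f. bij_betw f T S \<and> (\<forall>x\<in>T. \<forall>y\<in>T. edist d (f x) (f y) = edist d x y))"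

definition tiles :: "(nat \<Rightarrow> int) set \<Rightarrow> nat \<Rightarrow> bool" where
  "tiles T d \<longleftrightarrow> (\<exists>P. (\<forall>S\<in>P. is_copy d T S) \<and> \<Union>P = zspace d \<and>
      (\<forall>A\<in>P. \<forall>B\<in>P. A \<noteq> B \<longrightarrow> A \<inter> B = {}))"

end

theory Submission
  imports Defs "HOL-Library.Disjoint_Sets" "HOL-Library.FuncSet" "HOL-Library.Function_Algebras"
    "HOL-Number_Theory.Cong"
begin

text \<open>
  A generic linear map sends \<open>T\<close> injectively to a set \<open>A\<close> of \<open>k\<close> integers, and a tiling of \<open>Z^J\<close>
  by translates of \<open>A\<close> along the coordinate axes pulls back to a tiling by copies of \<open>T\<close>. Likewise
  it suffices to tile a product of finite abelian groups by images of \<open>A\<close> under affine maps.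

  On a cyclic group \<open>X\<close> of suitable order, all translates of \<open>A\<close> cover each point \<open>k\<close> times, and a
  linear recurrence modulo \<open>k\<close>, which is eventually periodic, gives a multiset of translates
  covering each point \<open>1\<close> modulo \<open>k\<close> times. Combining them in the two factors of \<open>B = X \<times> X\<close> gives
  coverings of \<open>B\<close> of constant multiplicities \<open>e + 1\<close> and \<open>e\<close>. With gadgets in further coordinates
  that can be completed by an arbitrary one of many disjoint sheets, these coverings are spread
  out into tilings, and yield for every point \<open>y\<close> of \<open>X^d\<close> a set \<open>W\<close> containing \<open>y\<close> such that both
  \<open>B \<times> W\<close> and \<open>B \<times> (W - {y})\<close> can be tiled. In the presence of \<open>B\<close>, single points can thus be
  added or removed freely.

  Let \<open>H\<close> be a group with a tileable subset \<open>U\<close> such that every \<open>v\<close> outside \<open>U\<close> lies in a tile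
  whose other points are in \<open>U\<close>. Then \<open>B \<times> (U \<times> X^d \<union> {p})\<close> can be tiled for every single point
  \<open>p\<close> of \<open>V = (H - U) \<times> X^d\<close>. In a power of \<open>H \<times> X^d\<close> with more than \<open>card V\<close> factors, each point
  with all coordinates in \<open>V\<close> can be assigned to a coordinate direction such that every line in
  that direction gets at most one point, so all of them are absorbed.
\<close>

section \<open>Tilings and their transport\<close>

definition tileable :: "'a set set \<Rightarrow> 'a set \<Rightarrow> bool" where
  "tileable F X \<longleftrightarrow> (\<exists>P\<subseteq>F. partition_on X P)"

lemma tileable_empty: "tileable F {}"
  by (auto simp: tileable_def partition_on_empty)

lemma tileable_tile:
  assumes "B \<in> F"
  shows "tileable F B"
proof (cases "B = {}")
  case False
  then show ?thesis
    using assms partition_on_space[OF False] unfolding tileable_def by (intro exI[of _ "{B}"]) auto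
qed (simp add: tileable_empty)

lemma tileable_UN:
  assumes "\<And>i. i \<in> I \<Longrightarrow> tileable F (X i)" and "disjoint_family_on X I"
  shows "tileable F (\<Union>i\<in>I. X i)"
proof -
  obtain P where P: "\<And>i. i \<in> I \<Longrightarrow> P i \<subseteq> F \<and> partition_on (X i) (P i)"
    using assms(1) unfolding tileable_def by metis
  then have Union_P: "\<Union>(P i) = X i" if "i \<in> I" for i
    using that by (simp add: partition_on_def)
  then have "disjoint_family_on (\<lambda>i. \<Union>(P i)) I"
    using assms(2) unfolding disjoint_family_on_def by simp
  then have "disjoint (\<Union>i\<in>I. P i)"
    using P by (intro disjoint_UN) (auto simp: partition_on_def)
  moreover have "{} \<notin> (\<Union>i\<in>I. P i)"
    using P by (auto simp: partition_on_def)
  ultimately have "partition_on (\<Union>i\<in>I. \<Union>(P i)) (\<Union>i\<in>I. P i)"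
    unfolding partition_on_def by blast
  then have "partition_on (\<Union>i\<in>I. X i) (\<Union>i\<in>I. P i)"
    using Union_P by simp
  then show ?thesis
    using P unfolding tileable_def by (intro exI[of _ "\<Union>i\<in>I. P i"]) blast
qed

lemma tileable_Un:
  assumes "tileable F X" "tileable F Y" "X \<inter> Y = {}"
  shows "tileable F (X \<union> Y)"
proof -
  have "tileable F (\<Union>b. if b then X else Y)"
    using assms by (intro tileable_UN) (auto simp: disjoint_family_on_def)
  then show ?thesis by (simp add: UNIV_bool Un_commute)
qed

lemma tileable_fibres:
  assumes "\<And>k. tileable F {x \<in> X. \<kappa> x = k}"
  shows "tileable F X"
proof -
  have "tileable F (\<Union>k. {x \<in> X. \<kappa> x = k})"
    using assms by (intro tileable_UN) (auto simp: disjoint_family_on_def)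
  moreover have "(\<Union>k. {x \<in> X. \<kappa> x = k}) = X" by blast
  ultimately show ?thesis by simp
qed

lemma tileable_partition:
  assumes "partition_on X P" and "\<And>B. B \<in> P \<Longrightarrow> tileable F B"
  shows "tileable F X"
proof -
  have "tileable F (\<Union>B\<in>P. B)"
    using assms by (intro tileable_UN)
      (auto simp: disjoint_family_on_def dest: partition_onD2 disjointD)
  then show ?thesis using partition_onD1[OF assms(1)] by simp
qed

lemma tileable_image:
  assumes "tileable F X" "inj_on g X" "\<And>B. B \<in> F \<Longrightarrow> B \<subseteq> X \<Longrightarrow> tileable G (g ` B)"
  shows "tileable G (g ` X)"
proof -
  obtain P where P: "P \<subseteq> F" "partition_on X P"
    using assms(1) unfolding tileable_def by blast
  show ?thesis
    using P partition_onD1[OF P(2)]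
    by (intro tileable_partition[OF partition_on_inj_image[OF P(2) assms(2)]])
      (auto intro!: assms(3))
qed

lemma tileable_vimage:
  assumes "tileable F X" "\<And>B. B \<in> F \<Longrightarrow> B \<subseteq> X \<Longrightarrow> tileable G {z \<in> Z. \<pi> z \<in> B}"
  shows "tileable G {z \<in> Z. \<pi> z \<in> X}"
proof -
  obtain P where P: "P \<subseteq> F" "partition_on X P"
    using assms(1) unfolding tileable_def by blast
  have "partition_on {z \<in> Z. \<pi> z \<in> X} ((\<lambda>B. {z \<in> Z. \<pi> z \<in> B}) ` P - {{}})"
    by (rule partition_on_transform[OF P(2)]) (auto simp: disjnt_iff)
  then show ?thesis
    using P partition_onD1[OF P(2)] by (elim tileable_partition) (auto intro!: assms(2))
qed

section \<open>Products and powers\<close>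

definition prod_tiles :: "'a set set \<Rightarrow> 'b set set \<Rightarrow> ('a \<times> 'b) set set" where
  "prod_tiles F G = {B \<times> {y} | B y. B \<in> F} \<union> {{x} \<times> C | x C. C \<in> G}"

definition pow_tiles :: "'a set set \<Rightarrow> 'i set \<Rightarrow> ('i \<Rightarrow> 'a) set set" where
  "pow_tiles F I = {(\<lambda>b. f(i := b)) ` B | f i B. i \<in> I \<and> B \<in> F}"

lemma prod_tilesE:
  assumes "D \<in> prod_tiles F G"
  obtains (left) B y where "B \<in> F" "D = B \<times> {y}" | (right) x C where "C \<in> G" "D = {x} \<times> C"
  using assms by (auto simp: prod_tiles_def)

lemma pow_tilesE:
  assumes "D \<in> pow_tiles F I"
  obtains f i B where "i \<in> I" "B \<in> F" "D = (\<lambda>b. f(i := b)) ` B"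
  using assms by (auto simp: pow_tiles_def)

lemma inj_on_fun_upd: "inj_on (\<lambda>b. f(i := b)) B"
  by (rule inj_onI) (rule fun_upd_eqD)

lemma tileable_Sigma:
  assumes "\<And>x. x \<in> X \<Longrightarrow> tileable G (Y x)"
  shows "tileable (prod_tiles F G) (Sigma X Y)"
proof -
  have "tileable (prod_tiles F G) (Pair x ` Y x)" if "x \<in> X" for x
  proof (rule tileable_image[OF assms[OF that]])
    fix B assume "B \<in> G"
    moreover have "Pair x ` B = {x} \<times> B" by auto
    ultimately show "tileable (prod_tiles F G) (Pair x ` B)"
      by (intro tileable_tile) (auto simp: prod_tiles_def)
  qed (simp add: inj_on_def)
  then have "tileable (prod_tiles F G) (\<Union>x\<in>X. Pair x ` Y x)"
    by (intro tileable_UN) (auto simp: disjoint_family_on_def)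
  moreover have "(\<Union>x\<in>X. Pair x ` Y x) = Sigma X Y" by auto
  ultimately show ?thesis by simp
qed

lemma tileable_Times:
  assumes "tileable F X"
  shows "tileable (prod_tiles F G) (X \<times> Y)"
proof -
  have "tileable (prod_tiles F G) (prod.swap ` (Y \<times> X))"
  proof (rule tileable_image[OF tileable_Sigma[OF assms]])
    fix D assume "D \<in> prod_tiles G F"
    then have "prod.swap ` D \<in> prod_tiles F G"
      by (cases rule: prod_tilesE) (auto simp: prod_tiles_def product_swap)
    then show "tileable (prod_tiles F G) (prod.swap ` D)" by (rule tileable_tile)
  qed simp
  then show ?thesis by (simp add: product_swap)
qed

text \<open>The tile through \<open>f\<close> is to lie on the line through \<open>f\<close> in direction \<open>dir f\<close>.\<close>

lemma tileable_lines:
  assumes "\<And>f. f \<in> X \<Longrightarrow> dir f \<in> I"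
    and "\<And>f. f \<in> X \<Longrightarrow> tileable F {b. f(dir f := b) \<in> X \<and> dir (f(dir f := b)) = dir f}"
  shows "tileable (pow_tiles F I) X"
proof (rule tileable_fibres)
  fix k
  let ?\<kappa> = "\<lambda>f. (dir f, f(dir f := undefined))"
  show "tileable (pow_tiles F I) {g \<in> X. ?\<kappa> g = k}"
  proof (cases "{g \<in> X. ?\<kappa> g = k} = {}")
    case True
    then show ?thesis by (simp only: tileable_empty)
  next
    case False
    then obtain f where f: "f \<in> X" "k = ?\<kappa> f" by blast
    define L where "L = {b. f(dir f := b) \<in> X \<and> dir (f(dir f := b)) = dir f}"
    have "{g \<in> X. ?\<kappa> g = k} = (\<lambda>b. f(dir f := b)) ` L"
    proof (intro equalityI subsetI)
      fix g assume "g \<in> {g \<in> X. ?\<kappa> g = k}"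
      then have g: "g \<in> X" "dir g = dir f" "g(dir f := undefined) = f(dir f := undefined)"
        using f(2) by auto
      then have "f(dir f := g (dir f)) = g" by (metis fun_upd_triv fun_upd_upd)
      then show "g \<in> (\<lambda>b. f(dir f := b)) ` L"
        using g unfolding L_def by (intro image_eqI[of _ _ "g (dir f)"]) auto
    qed (auto simp: L_def f(2))
    moreover have "tileable (pow_tiles F I) ((\<lambda>b. f(dir f := b)) ` L)"
    proof (rule tileable_image)
      show "tileable F L" unfolding L_def by (rule assms(2)[OF f(1)])
      show "tileable (pow_tiles F I) ((\<lambda>b. f(dir f := b)) ` B)" if "B \<in> F" for B
        using that assms(1)[OF f(1)] by (intro tileable_tile) (auto simp: pow_tiles_def)
    qed (rule inj_on_fun_upd)
    ultimately show ?thesis by simp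
  qed
qed

lemma tileable_Times_pow:
  fixes B :: "'a set"
  assumes "tileable (pow_tiles {L. tileable (prod_tiles F G) (B \<times> L)} I) X"
  shows "tileable (prod_tiles F (pow_tiles G I)) (B \<times> X)"
proof -
  let ?K = "prod_tiles F (pow_tiles G I)"
  have "tileable ?K {z \<in> B \<times> UNIV. snd z \<in> X}"
  proof (rule tileable_vimage[OF assms])
    fix D assume "D \<in> pow_tiles {L. tileable (prod_tiles F G) (B \<times> L)} I"
    then obtain f i L where i: "i \<in> I" and L: "tileable (prod_tiles F G) (B \<times> L)"
      and D: "D = (\<lambda>b. f(i := b)) ` L"
      by (auto elim: pow_tilesE)
    define line where "line = (\<lambda>(x :: 'a, b). (x, f(i := b)))"
    have line_Times: "line ` (S \<times> R) = S \<times> (\<lambda>b. f(i := b)) ` R" for S R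
      unfolding line_def by (subst image_paired_Times) simp
    have "tileable ?K (line ` (B \<times> L))"
    proof (rule tileable_image[OF L])
      show "inj_on line (B \<times> L)"
        by (rule inj_onI) (use inj_onD[OF inj_on_fun_upd, of f i] in \<open>auto simp: line_def\<close>)
      fix E assume "E \<in> prod_tiles F G"
      then show "tileable ?K (line ` E)"
      proof (cases rule: prod_tilesE)
        case (left A w)
        then show ?thesis by (simp add: line_Times tileable_Times tileable_tile)
      next
        case (right x C)
        then have "(\<lambda>b. f(i := b)) ` C \<in> pow_tiles G I"
          using i by (auto simp: pow_tiles_def)
        then show ?thesis using right(2) by (simp add: line_Times tileable_Sigma tileable_tile)
      qed
    qed
    moreover have "line ` (B \<times> L) = {z \<in> B \<times> UNIV. snd z \<in> D}"
      unfolding line_Times D by auto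
    ultimately show "tileable ?K {z \<in> B \<times> UNIV. snd z \<in> D}" by simp
  qed
  moreover have "{z \<in> B \<times> UNIV. snd z \<in> X} = B \<times> X" by auto
  ultimately show ?thesis by simp
qed

lemma tileable_insert_factor:
  assumes "tileable (prod_tiles F K) (B \<times> W)"
  shows "tileable (prod_tiles F (prod_tiles G K)) (B \<times> (Q \<times> W))"
proof -
  let ?Z = "UNIV \<times> (Q \<times> UNIV)" and ?\<pi> = "\<lambda>z. (fst z, snd (snd z))"
  have "tileable (prod_tiles F (prod_tiles G K)) {z \<in> ?Z. ?\<pi> z \<in> B \<times> W}"
  proof (rule tileable_vimage[OF assms])
    fix D assume "D \<in> prod_tiles F K"
    then show "tileable (prod_tiles F (prod_tiles G K)) {z \<in> ?Z. ?\<pi> z \<in> D}"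
    proof (cases rule: prod_tilesE)
      case (left A w)
      then have "{z \<in> ?Z. ?\<pi> z \<in> D} = A \<times> (Q \<times> {w})" by auto
      then show ?thesis using left(1) by (simp add: tileable_Times tileable_tile)
    next
      case (right x C)
      then have "{z \<in> ?Z. ?\<pi> z \<in> D} = {x} \<times> (Q \<times> C)" by auto
      then show ?thesis using right(1) by (simp add: tileable_Sigma tileable_tile)
    qed
  qed
  moreover have "{z \<in> ?Z. ?\<pi> z \<in> B \<times> W} = B \<times> (Q \<times> W)" by auto
  ultimately show ?thesis by simp
qed

section \<open>Multiple coverings\<close>

definition coverage :: "'a set list \<Rightarrow> 'a \<Rightarrow> nat" where
  "coverage L x = length (filter (\<lambda>C. x \<in> C) L)"

definition multicover :: "'a set set \<Rightarrow> 'a set \<Rightarrow> ('a \<Rightarrow> nat) \<Rightarrow> nat \<Rightarrow> bool" where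
  "multicover F X r s \<longleftrightarrow>
    (\<exists>L. length L = s \<and> (\<forall>C\<in>set L. C \<subseteq> X \<and> tileable F C) \<and> (\<forall>x\<in>X. coverage L x = r x))"

lemma multicover_cong:
  assumes "\<And>x. x \<in> X \<Longrightarrow> r x = r' x"
  shows "multicover F X r s \<longleftrightarrow> multicover F X r' s"
  using assms unfolding multicover_def by simp

lemma multicover_empties: "multicover F X (\<lambda>_. 0) s"
  unfolding multicover_def coverage_def
  by (intro exI[of _ "replicate s {}"]) (simp add: tileable_empty)

lemma multicover_tile: "B \<in> F \<Longrightarrow> B \<subseteq> X \<Longrightarrow> multicover F X (\<lambda>x. of_bool (x \<in> B)) 1"
  unfolding multicover_def coverage_def
  by (intro exI[of _ "[B]"]) (simp add: tileable_tile)

lemma multicover_add: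
  assumes "multicover F X r s" "multicover F X r' s'"
  shows "multicover F X (\<lambda>x. r x + r' x) (s + s')"
proof -
  obtain L where L: "length L = s" "\<forall>C\<in>set L. C \<subseteq> X \<and> tileable F C" "\<forall>x\<in>X. coverage L x = r x"
    using assms(1) unfolding multicover_def by blast
  obtain L' where L': "length L' = s'" "\<forall>C\<in>set L'. C \<subseteq> X \<and> tileable F C"
    "\<forall>x\<in>X. coverage L' x = r' x"
    using assms(2) unfolding multicover_def by blast
  show ?thesis
    unfolding multicover_def using L L' by (intro exI[of _ "L @ L'"]) (auto simp: coverage_def)
qed

lemma multicover_pad:
  assumes "multicover F X r s" "s \<le> s'"
  shows "multicover F X r s'"
  using multicover_add[OF assms(1) multicover_empties[of F X "s' - s"]] assms(2) by simp

lemma multicover_sum: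
  assumes "finite I" "\<And>i. i \<in> I \<Longrightarrow> multicover F X (r i) (s i)"
  shows "multicover F X (\<lambda>x. \<Sum>i\<in>I. r i x) (\<Sum>i\<in>I. s i)"
  using assms by (induction I) (simp_all add: multicover_empties multicover_add)

lemma multicover_scale:
  assumes "multicover F X r s"
  shows "multicover F X (\<lambda>x. m * r x) (m * s)"
  using multicover_sum[of "{..<m}" F X "\<lambda>_. r" "\<lambda>_. s"] assms by simp

lemma multicover_Times_left:
  assumes "multicover F X r s"
  shows "multicover (prod_tiles F G) (X \<times> Y) (\<lambda>(x, y). r x) s"
proof -
  obtain L where L: "length L = s" "\<forall>C\<in>set L. C \<subseteq> X \<and> tileable F C" "\<forall>x\<in>X. coverage L x = r x"
    using assms unfolding multicover_def by blast
  then show ?thesis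
    unfolding multicover_def
    by (intro exI[of _ "map (\<lambda>C. C \<times> Y) L"])
      (auto simp: coverage_def filter_map o_def intro!: tileable_Times)
qed

lemma multicover_Times_right:
  assumes "multicover G Y r s" "Q \<subseteq> X"
  shows "multicover (prod_tiles F G) (X \<times> Y) (\<lambda>(x, y). of_bool (x \<in> Q) * r y) s"
proof -
  obtain L where L: "length L = s" "\<forall>C\<in>set L. C \<subseteq> Y \<and> tileable G C" "\<forall>y\<in>Y. coverage L y = r y"
    using assms(1) unfolding multicover_def by blast
  then show ?thesis
    using assms(2) unfolding multicover_def
    by (intro exI[of _ "map (\<lambda>C. Q \<times> C) L"])
      (auto simp: coverage_def filter_map o_def intro!: tileable_Sigma)
qed

text \<open>The excess \<open>k * c x\<close> of the first covering is evened out in the second factor, by using more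
  copies of the \<open>k\<close>-fold covering over the points \<open>x\<close> where \<open>c x\<close> is small.\<close>

lemma ex_consecutive_multicovers:
  assumes X: "finite X"
    and cover_X: "multicover F X (\<lambda>x. Suc (k * c x)) s"
    and cover_Y: "multicover G Y (\<lambda>_. k) t"
  shows "\<exists>e q. multicover (prod_tiles F G) (X \<times> Y) (\<lambda>_. Suc e) (Suc e + q)
    \<and> multicover (prod_tiles F G) (X \<times> Y) (\<lambda>_. e) (e + q)"
proof -
  let ?K = "prod_tiles F G"
  define b where "b = Max (c ` X)"
  have c_le: "c x \<le> b" if "x \<in> X" for x
    unfolding b_def using X that by simp
  have "multicover ?K (X \<times> Y)
    (\<lambda>z. \<Sum>j<b. case z of (x, y) \<Rightarrow> of_bool (x \<in> {x \<in> X. c x \<le> j}) * k) (\<Sum>j<b. t)"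
    by (intro multicover_sum multicover_Times_right[OF cover_Y]) auto
  from multicover_add[OF multicover_Times_left[OF cover_X] this]
  have "multicover ?K (X \<times> Y) (\<lambda>_. Suc (k * b)) (s + (\<Sum>j<b. t))"
  proof (subst (asm) multicover_cong)
    fix z assume "z \<in> X \<times> Y"
    then obtain x y where z: "z = (x, y)" "x \<in> X" by blast
    have "(\<Sum>j<b. of_bool (x \<in> {x \<in> X. c x \<le> j}) * k) = (\<Sum>j\<in>{c x..<b}. k)"
      using z(2) by (intro sum.mono_neutral_cong_right) auto
    then have "Suc (k * c x) + (\<Sum>j<b. of_bool (x \<in> {x \<in> X. c x \<le> j}) * k)
        = Suc (k * (c x + (b - c x)))"
      by (simp add: algebra_simps)
    then show "(case z of (x, y) \<Rightarrow> Suc (k * c x))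
        + (\<Sum>j<b. case z of (x, y) \<Rightarrow> of_bool (x \<in> {x \<in> X. c x \<le> j}) * k) = Suc (k * b)"
      using c_le[OF z(2)] z(1) by simp
  qed
  moreover have "multicover ?K (X \<times> Y) (\<lambda>_. k * b) (b * t)"
    using multicover_scale[OF multicover_Times_right[OF cover_Y subset_refl], where m = b]
    by (subst (asm) multicover_cong[where r' = "\<lambda>_. k * b"]) auto
  ultimately show ?thesis
    by (intro exI[of _ "k * b"] exI[of _ "s + b * t"] conjI; elim multicover_pad) simp_all
qed

section \<open>Adding and removing a point\<close>

text \<open>The fillers \<open>E g\<close> can be combined with any choice of \<open>q\<close> of the sheets \<open>Z i\<close>.\<close>

definition gadget :: "'a set set \<Rightarrow> nat \<Rightarrow> nat \<Rightarrow> (nat \<Rightarrow> 'a set) \<Rightarrow> (nat \<Rightarrow> 'a set) \<Rightarrow> bool" where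
  "gadget G q s E Z \<longleftrightarrow> disjoint_family_on E {..<q} \<and> disjoint_family_on Z {..<s}
    \<and> (\<forall>g<q. \<forall>i<s. E g \<inter> Z i = {} \<and> tileable G (E g \<union> Z i))"

lemma tileable_gadget:
  assumes "gadget G q s E Z" "N \<subseteq> {..<s}" "card N = q"
  shows "tileable G ((\<Union>g<q. E g) \<union> (\<Union>i\<in>N. Z i))"
proof -
  obtain h where h: "bij_betw h {..<q} N"
    using ex_bij_betw_nat_finite[of N] assms(2,3) finite_subset
    by (metis atLeast0LessThan finite_lessThan)
  have h_less: "h g < s" if "g < q" for g
    using bij_betwE[OF h] that assms(2) by auto
  have "tileable G (\<Union>g<q. E g \<union> Z (h g))"
  proof (rule tileable_UN)
    show "disjoint_family_on (\<lambda>g. E g \<union> Z (h g)) {..<q}"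
      unfolding disjoint_family_on_def
    proof (intro ballI impI)
      fix g g' assume g: "g \<in> {..<q}" "g' \<in> {..<q}" "g \<noteq> g'"
      have "h g \<noteq> h g'"
        using bij_betw_imp_inj_on[OF h] g by (auto simp: inj_on_def)
      then have "Z (h g) \<inter> Z (h g') = {}" "E g \<inter> E g' = {}"
        "E g \<inter> Z (h g') = {}" "E g' \<inter> Z (h g) = {}"
        using assms(1) g h_less by (auto simp: gadget_def disjoint_family_on_def)
      then show "(E g \<union> Z (h g)) \<inter> (E g' \<union> Z (h g')) = {}" by blast
    qed
  qed (use assms(1) h_less in \<open>auto simp: gadget_def\<close>)
  moreover have "(\<Union>g<q. E g \<union> Z (h g)) = (\<Union>g<q. E g) \<union> (\<Union>i\<in>N. Z i)"
    using bij_betw_imp_surj_on[OF h] by blast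
  ultimately show ?thesis by simp
qed

lemma multicover_uncovered:
  assumes "multicover F X (\<lambda>_. c) (c + q)"
  shows "\<exists>C. (\<forall>i<c + q. C i \<subseteq> X \<and> tileable F (C i)) \<and> (\<forall>x\<in>X. card {i. i < c + q \<and> x \<notin> C i} = q)"
proof -
  obtain L where L: "length L = c + q" "\<And>C. C \<in> set L \<Longrightarrow> C \<subseteq> X \<and> tileable F C"
    "\<And>x. x \<in> X \<Longrightarrow> coverage L x = c"
    using assms unfolding multicover_def by blast
  have "card {i. i < c + q \<and> x \<notin> L ! i} = q" if "x \<in> X" for x
  proof -
    have "card {i. i < c + q \<and> x \<notin> L ! i} = length (filter (\<lambda>C. x \<notin> C) L)"
      by (simp add: length_filter_conv_card L(1))
    then show ?thesis
      using sum_length_filter_compl[of "\<lambda>C. x \<in> C" L] L(1) L(3)[OF that]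
      by (simp add: coverage_def)
  qed
  then show ?thesis using L(1,2) by (intro exI[of _ "(!) L"]) simp
qed

text \<open>Place the \<open>i\<close>-th member of the covering along \<open>Z i\<close>. Over each point of \<open>B\<close> exactly \<open>q\<close> of the
  sheets remain free, and the fillers complete them.\<close>

lemma tileable_Times_gadget:
  assumes cover: "multicover F B (\<lambda>_. c) (c + q)" and gadget: "gadget G q (c + q) E Z"
  shows "tileable (prod_tiles F G) (B \<times> ((\<Union>g<q. E g) \<union> (\<Union>i<c + q. Z i)))"
proof -
  obtain C where C: "\<And>i. i < c + q \<Longrightarrow> C i \<subseteq> B" "\<And>i. i < c + q \<Longrightarrow> tileable F (C i)"
    and uncovered: "\<And>x. x \<in> B \<Longrightarrow> card {i. i < c + q \<and> x \<notin> C i} = q"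
    using multicover_uncovered[OF cover] by blast
  have disjoint_Z: "disjoint_family_on Z {..<c + q}"
    using gadget by (simp add: gadget_def)
  define free where "free x = {i. i < c + q \<and> x \<notin> C i}" for x
  let ?Y = "\<lambda>x. (\<Union>g<q. E g) \<union> (\<Union>i\<in>free x. Z i)"
  have "tileable (prod_tiles F G) (Sigma B ?Y)"
    using uncovered by (intro tileable_Sigma tileable_gadget[OF gadget]) (auto simp: free_def)
  moreover have "tileable (prod_tiles F G) (\<Union>i<c + q. C i \<times> Z i)"
  proof (intro tileable_UN tileable_Times)
    show "disjoint_family_on (\<lambda>i. C i \<times> Z i) {..<c + q}"
      using disjoint_Z by (simp add: disjoint_family_on_def Times_Int_Times)
  qed (simp add: C)
  moreover have "Sigma B ?Y \<inter> (\<Union>i<c + q. C i \<times> Z i) = {}"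
  proof -
    have False if "x \<in> C i" "i < c + q" "y \<in> Z i" "y \<in> ?Y x" for x y i
    proof -
      have "y \<notin> E g" if "g < q" for g
        using gadget \<open>y \<in> Z i\<close> \<open>i < c + q\<close> that by (auto simp: gadget_def)
      then obtain j where "j \<in> free x" "y \<in> Z j" using \<open>y \<in> ?Y x\<close> by blast
      then show False
        using disjoint_family_onD[OF disjoint_Z, of i j] that(1-3)
        by (cases "i = j") (auto simp: free_def)
    qed
    then show ?thesis by blast
  qed
  ultimately have "tileable (prod_tiles F G) (Sigma B ?Y \<union> (\<Union>i<c + q. C i \<times> Z i))"
    by (rule tileable_Un)
  moreover have "Sigma B ?Y \<union> (\<Union>i<c + q. C i \<times> Z i) = B \<times> ((\<Union>g<q. E g) \<union> (\<Union>i<c + q. Z i))"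
    using C(1) unfolding free_def by blast
  ultimately show ?thesis by simp
qed

definition switchable :: "'b set set \<Rightarrow> 'b set \<Rightarrow> 'a set set \<Rightarrow> 'a set \<Rightarrow> 'a \<Rightarrow> bool" where
  "switchable F B G Y y \<longleftrightarrow> (\<exists>W\<subseteq>Y. y \<in> W
    \<and> tileable (prod_tiles F G) (B \<times> W) \<and> tileable (prod_tiles F G) (B \<times> (W - {y})))"

lemma switchable_if_gadget:
  assumes covers: "multicover F B (\<lambda>_. Suc c) (Suc c + q)" "multicover F B (\<lambda>_. c) (c + q)"
    and gadget: "gadget G q (Suc c + q) E Z" and Z0: "Z 0 = {y}"
    and sub: "\<And>g. g < q \<Longrightarrow> E g \<subseteq> Y" "\<And>i. i < Suc c + q \<Longrightarrow> Z i \<subseteq> Y"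
  shows "switchable F B G Y y"
proof -
  let ?W = "(\<Union>g<q. E g) \<union> (\<Union>i<Suc c + q. Z i)"
  have "gadget G q (c + q) E (\<lambda>i. Z (Suc i))"
    using gadget by (auto simp: gadget_def disjoint_family_on_def)
  from tileable_Times_gadget[OF covers(2) this]
  have "tileable (prod_tiles F G) (B \<times> ((\<Union>g<q. E g) \<union> (\<Union>i<c + q. Z (Suc i))))" .
  moreover have "?W - {y} = (\<Union>g<q. E g) \<union> (\<Union>i<c + q. Z (Suc i))"
  proof -
    have "y \<notin> Z (Suc i)" if "i < c + q" for i
      using disjoint_family_onD[of Z "{..<Suc c + q}" 0 "Suc i"] gadget Z0 that
      by (auto simp: gadget_def)
    moreover have "y \<notin> E g" if "g < q" for g
      using gadget Z0 that by (auto simp: gadget_def)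
    moreover have "(\<Union>i<Suc c + q. Z i) = insert y (\<Union>i<c + q. Z (Suc i))"
      using Z0 by (simp add: lessThan_Suc_eq_insert_0 image_image)
    ultimately show ?thesis by auto
  qed
  moreover have "tileable (prod_tiles F G) (B \<times> ?W)"
    by (rule tileable_Times_gadget[OF covers(1) gadget])
  moreover have "?W \<subseteq> Y" using sub by blast
  moreover have "y \<in> ?W" using Z0 by auto
  ultimately show ?thesis unfolding switchable_def by (intro exI[of _ ?W]) simp
qed

text \<open>Tilings of cubes by axis-parallel tiles reduce to pairing \<open>J\<close> with \<open>insert j J\<close>.\<close>

definition cubes :: "('i \<Rightarrow> 'a) \<Rightarrow> ('i \<Rightarrow> 'a set) \<Rightarrow> 'i set set \<Rightarrow> ('i \<Rightarrow> 'a) set" where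
  "cubes y C \<J> = {f. {j. f j \<noteq> y j} \<in> \<J> \<and> (\<forall>j. f j \<noteq> y j \<longrightarrow> f j \<in> C j)}"

lemma cubes_Un: "cubes y C (\<I> \<union> \<J>) = cubes y C \<I> \<union> cubes y C \<J>"
  by (auto simp: cubes_def)

lemma cubes_disjoint: "\<I> \<inter> \<J> = {} \<Longrightarrow> cubes y C \<I> \<inter> cubes y C \<J> = {}"
  by (auto simp: cubes_def)

lemma cubes_empty: "cubes y C {{}} = {y}"
  by (auto simp: cubes_def)

lemma cubes_subset_PiE:
  assumes "y \<in> PiE I X" "\<And>J. J \<in> \<J> \<Longrightarrow> J \<subseteq> I" "\<And>i. i \<in> I \<Longrightarrow> C i \<subseteq> X i"
  shows "cubes y C \<J> \<subseteq> PiE I X"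
proof
  fix f assume f: "f \<in> cubes y C \<J>"
  show "f \<in> PiE I X"
  proof (rule PiE_I)
    fix i assume "i \<in> I"
    then show "f i \<in> X i"
      using f assms(1,3) by (cases "f i = y i") (auto simp: cubes_def)
  next
    fix i assume "i \<notin> I"
    moreover from this have "f i = y i" using f assms(2) by (auto simp: cubes_def)
    ultimately show "f i = undefined" using PiE_arb[OF assms(1)] by simp
  qed
qed

lemma tileable_cubes_Un:
  assumes "tileable F (cubes y C \<I>)" "tileable F (cubes y C \<J>)" "\<I> \<inter> \<J> = {}"
  shows "tileable F (cubes y C (\<I> \<union> \<J>))"
  using tileable_Un[OF assms(1,2) cubes_disjoint[OF assms(3)]] by (simp only: cubes_Un)

lemma tileable_cubes_pair:
  assumes "j \<notin> J" "j \<in> I" "C j \<in> F" "y j \<in> C j"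
  shows "tileable (pow_tiles F I) (cubes y C {J, insert j J})"
proof (rule tileable_lines)
  fix f assume f: "f \<in> cubes y C {J, insert j J}"
  then have supp: "{i. f i \<noteq> y i} - {j} = J"
    using assms(1) by (auto simp: cubes_def)
  have "f(j := b) \<in> cubes y C {J, insert j J} \<longleftrightarrow> b \<in> C j" for b
  proof -
    have "{i. (f(j := b)) i \<noteq> y i} = (if b = y j then J else insert j J)"
      using supp by auto
    then show ?thesis
      using f assms(4) by (auto simp: cubes_def)
  qed
  then show "tileable F {b. f(j := b) \<in> cubes y C {J, insert j J} \<and> j = j}"
    using assms(3) by (simp add: tileable_tile)
qed (use assms(2) in simp)

definition segments :: "nat \<Rightarrow> nat set \<Rightarrow> nat set set" where
  "segments e K = (\<lambda>j. insert e {..<j}) ` K"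

lemma segments_disjoint:
  assumes "K \<subseteq> {..e}" "K' \<subseteq> {..e}" "K \<inter> K' = {}"
  shows "segments e K \<inter> segments e K' = {}"
proof -
  have "inj_on (\<lambda>j. insert e {..<j}) {..e}"
    by (rule inj_onI) (metis atMost_iff insert_ident lessThan_eq_iff lessThan_iff not_le)
  then show ?thesis
    using assms unfolding segments_def by (metis image_empty inj_on_image_Int)
qed

lemma tileable_cubes_segments:
  assumes "a + 2 * n \<le> e" "e < d" and C: "\<And>j. j < d \<Longrightarrow> C j \<in> F \<and> y j \<in> C j"
  shows "tileable (pow_tiles F {..<d}) (cubes y C (segments e {a..<a + 2 * n}))"
  using assms(1)
proof (induction n)
  case 0
  show ?case by (simp add: segments_def cubes_def tileable_empty)
next
  case (Suc n)
  define m where "m = a + 2 * n"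
  have m: "Suc m < e" using Suc.prems by (simp add: m_def)
  have "{a..<a + 2 * Suc n} = {a..<m} \<union> {m, Suc m}" by (auto simp: m_def)
  then have "segments e {a..<a + 2 * Suc n} = segments e {a..<m} \<union> segments e {m, Suc m}"
    by (simp add: segments_def image_Un)
  moreover have "tileable (pow_tiles F {..<d}) (cubes y C (segments e {m, Suc m}))"
  proof -
    have "segments e {m, Suc m} = {insert e {..<m}, insert m (insert e {..<m})}"
      by (simp add: segments_def lessThan_Suc insert_commute)
    then show ?thesis
      using C[of m] m assms(2) by (simp only:) (intro tileable_cubes_pair, auto)
  qed
  moreover have "tileable (pow_tiles F {..<d}) (cubes y C (segments e {a..<m}))"
    using Suc by (simp add: m_def)
  moreover have "segments e {a..<m} \<inter> segments e {m, Suc m} = {}"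
    using m by (intro segments_disjoint) auto
  ultimately show ?case by (simp only: tileable_cubes_Un)
qed

text \<open>Removing the even position \<open>2 * i\<close> from the chain of \<open>2 * s - 1\<close> segments leaves two pieces of
  even length; the removed set is matched with \<open>{..<2 * i}\<close> instead.\<close>

lemma tileable_cubes_segments_insert:
  assumes "i < s" "2 * s \<le> e" "e < d" and C: "\<And>j. j < d \<Longrightarrow> C j \<in> F \<and> y j \<in> C j"
  shows "tileable (pow_tiles F {..<d}) (cubes y C (segments e {..<2 * s - 1} \<union> {{..<2 * i}}))"
proof -
  define lower where "lower = segments e {0..<0 + 2 * i}"
  define upper where "upper = segments e {Suc (2 * i)..<Suc (2 * i) + 2 * (s - Suc i)}"
  define pair where "pair = {{..<2 * i}, insert e {..<2 * i}}"
  have "{..<2 * s - 1} = {0..<0 + 2 * i} \<union> {Suc (2 * i)..<Suc (2 * i) + 2 * (s - Suc i)} \<union> {2 * i}"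
    using assms(1) by auto
  then have "segments e {..<2 * s - 1} \<union> {{..<2 * i}} = lower \<union> upper \<union> pair"
    unfolding segments_def lower_def upper_def pair_def by (auto simp only: image_Un)
  moreover have "tileable (pow_tiles F {..<d}) (cubes y C (lower \<union> upper \<union> pair))"
  proof (intro tileable_cubes_Un)
    show "tileable (pow_tiles F {..<d}) (cubes y C lower)"
      unfolding lower_def using assms by (intro tileable_cubes_segments) auto
    show "tileable (pow_tiles F {..<d}) (cubes y C upper)"
      unfolding upper_def using assms by (intro tileable_cubes_segments) auto
    show "tileable (pow_tiles F {..<d}) (cubes y C pair)"
      unfolding pair_def using assms by (intro tileable_cubes_pair) auto
    show "lower \<inter> upper = {}"
      unfolding lower_def upper_def using assms(1,2) by (intro segments_disjoint) auto
    have "lower \<inter> segments e {2 * i} = {}" "upper \<inter> segments e {2 * i} = {}"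
      unfolding lower_def upper_def using assms(1,2) by (intro segments_disjoint; auto)+
    moreover have "e \<in> J" if "J \<in> lower \<union> upper" for J
      using that by (auto simp: lower_def upper_def segments_def)
    then have "{..<2 * i} \<notin> lower \<union> upper"
      using assms(1,2) by fastforce
    moreover have "pair = {{..<2 * i}} \<union> segments e {2 * i}" by (auto simp: pair_def segments_def)
    ultimately show "(lower \<union> upper) \<inter> pair = {}" by blast
  qed
  ultimately show ?thesis by simp
qed

lemma gadget_cubes:
  assumes "d = 2 * s + q" and C: "\<And>j. j < d \<Longrightarrow> C j \<in> F \<and> y j \<in> C j"
  shows "gadget (pow_tiles F {..<d}) q s
    (\<lambda>g. cubes y C (segments (2 * s + g) {..<2 * s - 1})) (\<lambda>i. cubes y C {{..<2 * i}})"
  unfolding gadget_def disjoint_family_on_def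
proof (intro conjI ballI allI impI)
  let ?filler = "\<lambda>g. segments (2 * s + g) {..<2 * s - 1}"
  have top: "2 * s + g \<in> J" "J \<inter> {2 * s..} = {2 * s + g}" if "J \<in> ?filler g" for J g
    using that by (auto simp: segments_def)
  show "cubes y C (?filler g) \<inter> cubes y C (?filler h) = {}" if "g \<noteq> h" for g h
  proof (intro cubes_disjoint Int_emptyI)
    fix J assume "J \<in> ?filler g" "J \<in> ?filler h"
    then have "{2 * s + g} = {2 * s + h}" using top(2) by metis
    then show False using that by simp
  qed
  show "cubes y C {{..<2 * i}} \<inter> cubes y C {{..<2 * j}} = {}" if "i \<noteq> j" for i j
    using that by (intro cubes_disjoint) auto
  fix g i assume "g < q" "i < s"
  then show "cubes y C (?filler g) \<inter> cubes y C {{..<2 * i}} = {}"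
    using top(1)[of _ g] by (intro cubes_disjoint) fastforce
  show "tileable (pow_tiles F {..<d}) (cubes y C (?filler g) \<union> cubes y C {{..<2 * i}})"
    using \<open>g < q\<close> \<open>i < s\<close> assms unfolding cubes_Un[symmetric]
    by (intro tileable_cubes_segments_insert) auto
qed

lemma switchable_power:
  assumes covers: "multicover FB B (\<lambda>_. Suc c) (Suc c + q)" "multicover FB B (\<lambda>_. c) (c + q)"
    and F: "\<And>x. x \<in> X \<Longrightarrow> \<exists>C\<in>F. x \<in> C \<and> C \<subseteq> X"
    and d: "d = 2 * (Suc c + q) + q" and y: "y \<in> {..<d} \<rightarrow>\<^sub>E X"
  shows "switchable FB B (pow_tiles F {..<d}) ({..<d} \<rightarrow>\<^sub>E X) y"
proof -
  have "\<forall>j<d. \<exists>C. C \<in> F \<and> y j \<in> C \<and> C \<subseteq> X"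
    using F y by blast
  then obtain C where C: "\<And>j. j < d \<Longrightarrow> C j \<in> F \<and> y j \<in> C j \<and> C j \<subseteq> X"
    by metis
  show ?thesis
  proof (rule switchable_if_gadget[OF covers gadget_cubes[OF d]])
    show "cubes y C {{..<2 * 0}} = {y}" by (simp add: cubes_empty)
    show "cubes y C (segments (2 * (Suc c + q) + g) {..<2 * (Suc c + q) - 1}) \<subseteq> {..<d} \<rightarrow>\<^sub>E X"
      if "g < q" for g
      using C that by (intro cubes_subset_PiE[OF y]) (auto simp: segments_def d)
    show "cubes y C {{..<2 * i}} \<subseteq> {..<d} \<rightarrow>\<^sub>E X" if "i < Suc c + q" for i
      using C that by (intro cubes_subset_PiE[OF y]) (auto simp: d)
  qed (use C in blast)
qed

section \<open>Absorbing all points of a power\<close>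

lemma tileable_absorb_point:
  assumes U: "tileable FH U" and C: "C \<in> FH" "v \<in> C" "C - {v} \<subseteq> U" "v \<notin> U"
    and y: "switchable FB B FY Y y"
  shows "tileable (prod_tiles FB (prod_tiles FH FY)) (B \<times> (U \<times> Y \<union> {(v, y)}))"
proof -
  let ?t = "tileable (prod_tiles FB (prod_tiles FH FY))"
  obtain W where W: "W \<subseteq> Y" "y \<in> W" "tileable (prod_tiles FB FY) (B \<times> W)"
    "tileable (prod_tiles FB FY) (B \<times> (W - {y}))"
    using y unfolding switchable_def by blast
  define D where "D = C - {v}"
  have "?t (B \<times> (C \<times> {y}))" by (intro tileable_Sigma tileable_Times tileable_tile C)
  moreover have "?t (B \<times> (U \<times> (Y - W)))" by (intro tileable_Sigma[of B] tileable_Times U)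
  moreover have "?t (B \<times> ((U - D) \<times> W))" by (rule tileable_insert_factor[OF W(3)])
  moreover have "?t (B \<times> (D \<times> (W - {y})))" by (rule tileable_insert_factor[OF W(4)])
  ultimately have "?t (B \<times> (C \<times> {y})
      \<union> (B \<times> (U \<times> (Y - W)) \<union> (B \<times> ((U - D) \<times> W) \<union> B \<times> (D \<times> (W - {y})))))"
    using C W(1,2) by (intro tileable_Un) (auto simp: D_def)
  moreover have "B \<times> (C \<times> {y}) \<union> (B \<times> (U \<times> (Y - W)) \<union> (B \<times> ((U - D) \<times> W) \<union> B \<times> (D \<times> (W - {y}))))
      = B \<times> (U \<times> Y \<union> {(v, y)})"
    using C W(1,2) unfolding D_def by blast
  ultimately show ?thesis by simp
qed

text \<open>Number the points of \<open>V\<close> and add up the coordinates modulo \<open>m\<close>.\<close>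

lemma ex_latin_labelling:
  assumes "finite V" "card V < m"
  shows "\<exists>\<chi> :: (nat \<Rightarrow> 'a) \<Rightarrow> nat.
    (\<forall>f. \<chi> f < m) \<and> (\<forall>f. \<forall>i<m. inj_on (\<lambda>b. \<chi> (f(i := b))) V)"
proof -
  obtain e where e: "bij_betw e V {..<card V}"
    using ex_bij_betw_finite_nat[OF assms(1)] by (metis atLeast0LessThan)
  define \<chi> where "\<chi> f = (\<Sum>j<m. e (f j)) mod m" for f
  have "inj_on (\<lambda>b. \<chi> (f(i := b))) V" if "i < m" for f i
  proof (rule inj_onI)
    fix b b' assume b: "b \<in> V" "b' \<in> V" and eq: "\<chi> (f(i := b)) = \<chi> (f(i := b'))"
    have "(\<Sum>j<m. e ((f(i := b)) j)) = e b + (\<Sum>j\<in>{..<m} - {i}. e (f j))" for b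
      using that by (simp add: sum.remove[of "{..<m}" i])
    then have "[e b = e b'] (mod m)"
      using eq by (simp add: \<chi>_def cong_add_rcancel_nat flip: cong_def)
    moreover have "e b < m" "e b' < m"
      using bij_betwE[OF e] b assms(2) by fastforce+
    ultimately have "e b = e b'" by (rule cong_less_modulus_unique_nat)
    then show "b = b'" using bij_betw_imp_inj_on[OF e] b by (auto dest: inj_onD)
  qed
  moreover have "\<chi> f < m" for f using assms(2) by (simp add: \<chi>_def)
  ultimately show ?thesis by blast
qed

definition escapes :: "'a set \<Rightarrow> nat \<Rightarrow> (nat \<Rightarrow> 'a) \<Rightarrow> nat set" where
  "escapes V m f = {i. i < m \<and> f i \<notin> V}"

text \<open>A function with a value outside \<open>V\<close> gets a direction in which it leaves \<open>V\<close>; any other one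
  gets its label \<open>\<chi> f\<close>. If \<open>\<chi>\<close> is injective on lines, each line takes up at most one such function.\<close>

definition direction :: "'a set \<Rightarrow> nat \<Rightarrow> ((nat \<Rightarrow> 'a) \<Rightarrow> nat) \<Rightarrow> (nat \<Rightarrow> 'a) \<Rightarrow> nat" where
  "direction V m \<chi> f = (if escapes V m f = {} then \<chi> f else (SOME i. i \<in> escapes V m f))"

lemma escapes_fun_upd:
  "i < m \<Longrightarrow> escapes V m (f(i := b)) = (escapes V m f - {i}) \<union> (if b \<in> V then {} else {i})"
  by (auto simp: escapes_def)

lemma direction_in_escapes: "escapes V m f \<noteq> {} \<Longrightarrow> direction V m \<chi> f \<in> escapes V m f"
  using some_in_eq[of "escapes V m f"] by (simp add: direction_def)

lemma direction_less:
  assumes "\<chi> f < m"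
  shows "direction V m \<chi> f < m"
  using assms direction_in_escapes[of V m f \<chi>]
  by (cases "escapes V m f = {}") (auto simp: direction_def escapes_def)

lemma direction_fun_upd_if_escapes_subset:
  assumes "i < m" "escapes V m f \<subseteq> {i}"
  shows "direction V m \<chi> (f(i := b)) = i \<longleftrightarrow> b \<notin> V \<or> \<chi> (f(i := b)) = i"
proof -
  have "escapes V m (f(i := b)) = (if b \<in> V then {} else {i})"
    using escapes_fun_upd[OF assms(1), of V f b] assms(2) by auto
  then show ?thesis by (simp add: direction_def)
qed

lemma direction_fun_upd_if_escapes:
  assumes "l \<in> escapes V m f" "l \<noteq> direction V m \<chi> f"
  shows "direction V m \<chi> (f(direction V m \<chi> f := b)) = direction V m \<chi> f \<longleftrightarrow> b \<notin> V"
proof -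
  define i where "i = direction V m \<chi> f"
  have i: "i \<in> escapes V m f"
    using direction_in_escapes[of V m f] assms(1) unfolding i_def by blast
  then have upd: "escapes V m (f(i := b)) = (escapes V m f - {i}) \<union> (if b \<in> V then {} else {i})"
    by (intro escapes_fun_upd) (simp add: escapes_def)
  have "direction V m \<chi> (f(i := b)) = i \<longleftrightarrow> b \<notin> V"
  proof (cases "b \<in> V")
    case True
    then have "l \<in> escapes V m (f(i := b))" "i \<notin> escapes V m (f(i := b))"
      using assms upd by (auto simp: i_def)
    moreover from this have "direction V m \<chi> (f(i := b)) \<in> escapes V m (f(i := b))"
      by (intro direction_in_escapes) blast
    ultimately show ?thesis using True by metis
  next
    case False
    then have "escapes V m (f(i := b)) = escapes V m f" using upd i by auto
    then have "direction V m \<chi> (f(i := b)) = direction V m \<chi> f"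
      using assms(1) by (auto simp: direction_def)
    then show ?thesis using False by (simp add: i_def)
  qed
  then show ?thesis by (simp only: i_def)
qed

lemma ex_directions:
  fixes V :: "'a set"
  assumes "finite V"
  shows "\<exists>m (dir :: (nat \<Rightarrow> 'a) \<Rightarrow> nat). \<forall>f. dir f < m
    \<and> {b. dir (f(dir f := b)) = dir f} \<in> insert (- V) ((\<lambda>v. insert v (- V)) ` V)"
proof -
  define m where "m = Suc (card V)"
  obtain \<chi> :: "(nat \<Rightarrow> 'a) \<Rightarrow> nat"
    where \<chi>: "\<And>f. \<chi> f < m" "\<And>f i. i < m \<Longrightarrow> inj_on (\<lambda>b. \<chi> (f(i := b))) V"
    using ex_latin_labelling[OF assms, of m] unfolding m_def by auto
  define dir where "dir = direction V m \<chi>"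
  have dir_less: "dir f < m" for f
    unfolding dir_def using \<chi>(1) by (rule direction_less)
  have "{b. dir (f(dir f := b)) = dir f} \<in> insert (- V) ((\<lambda>v. insert v (- V)) ` V)" for f
  proof (cases "escapes V m f \<subseteq> {dir f}")
    case True
    then have line: "{b. dir (f(dir f := b)) = dir f} = - V \<union> {v \<in> V. \<chi> (f(dir f := v)) = dir f}"
      using direction_fun_upd_if_escapes_subset[OF dir_less True] unfolding dir_def by auto
    consider (none) "{v \<in> V. \<chi> (f(dir f := v)) = dir f} = {}"
      | (point) v where "v \<in> V" "\<chi> (f(dir f := v)) = dir f"
      by blast
    then show ?thesis
    proof cases
      case (point v)
      have inj_line: "inj_on (\<lambda>b. \<chi> (f(dir f := b))) V" by (rule \<chi>(2)[OF dir_less])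
      have "b = v" if "b \<in> V" "\<chi> (f(dir f := b)) = dir f" for b
        using inj_onD[OF inj_line _ that(1) point(1)] that(2) point(2) by simp
      then have "{v \<in> V. \<chi> (f(dir f := v)) = dir f} = {v}" using point by blast
      then show ?thesis unfolding line using point(1) by simp
    qed (simp only: line Un_empty_right insertI1)
  next
    case False
    then obtain l where "l \<in> escapes V m f" "l \<noteq> dir f" by blast
    then have "{b. dir (f(dir f := b)) = dir f} = - V"
      using direction_fun_upd_if_escapes[of l V m f \<chi>] by (auto simp: dir_def)
    then show ?thesis by simp
  qed
  then show ?thesis using dir_less by blast
qed

lemma ex_tileable_power:
  fixes V :: "'a set"
  assumes V: "finite V" "V \<subseteq> Y"
    and base: "tileable (prod_tiles F G) (B \<times> (Y - V))"
    and V_point: "\<And>v. v \<in> V \<Longrightarrow> tileable (prod_tiles F G) (B \<times> ((Y - V) \<union> {v}))"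
  shows "\<exists>m::nat. tileable (prod_tiles F (pow_tiles G {..<m})) (B \<times> ({..<m} \<rightarrow>\<^sub>E Y))"
proof -
  obtain m and dir :: "(nat \<Rightarrow> 'a) \<Rightarrow> nat" where dir_less: "\<And>f. dir f < m"
    and line: "\<And>f. {b. dir (f(dir f := b)) = dir f} \<in> insert (- V) ((\<lambda>v. insert v (- V)) ` V)"
    using ex_directions[OF V(1)] by blast
  have "tileable (prod_tiles F G)
      (B \<times> {b. f(dir f := b) \<in> {..<m} \<rightarrow>\<^sub>E Y \<and> dir (f(dir f := b)) = dir f})"
    if f: "f \<in> {..<m} \<rightarrow>\<^sub>E Y" for f
  proof -
    have "f(dir f := b) \<in> {..<m} \<rightarrow>\<^sub>E Y \<longleftrightarrow> b \<in> Y" for b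
      using f dir_less[of f] by (auto simp: PiE_iff extensional_def split: if_splits)
    then have "{b. f(dir f := b) \<in> {..<m} \<rightarrow>\<^sub>E Y \<and> dir (f(dir f := b)) = dir f}
        = Y \<inter> {b. dir (f(dir f := b)) = dir f}" by auto
    moreover consider (none) "{b. dir (f(dir f := b)) = dir f} = - V"
      | (point) v where "v \<in> V" "{b. dir (f(dir f := b)) = dir f} = insert v (- V)"
      using line[of f] by blast
    then have "tileable (prod_tiles F G) (B \<times> (Y \<inter> {b. dir (f(dir f := b)) = dir f}))"
    proof cases
      case none
      then show ?thesis using base by (simp add: Diff_eq)
    next
      case (point v)
      then have "Y \<inter> {b. dir (f(dir f := b)) = dir f} = (Y - V) \<union> {v}"
        using V(2) by blast
      then show ?thesis using V_point[OF point(1)] by simp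
    qed
    ultimately show ?thesis by simp
  qed
  then have "tileable (prod_tiles F (pow_tiles G {..<m})) (B \<times> ({..<m} \<rightarrow>\<^sub>E Y))"
    using dir_less by (intro tileable_Times_pow tileable_lines[where dir = dir] tileable_tile) auto
  then show ?thesis by blast
qed

lemma ex_tileable_product:
  assumes X: "finite X"
    and covers: "multicover F X (\<lambda>x. Suc (k * c x)) s" "multicover F X (\<lambda>_. k) t"
    and F: "\<And>x. x \<in> X \<Longrightarrow> \<exists>C\<in>F. x \<in> C \<and> C \<subseteq> X"
    and H: "finite H" "U \<subseteq> H" "tileable FH U"
    and H_minus_U: "\<And>v. v \<in> H - U \<Longrightarrow> \<exists>C\<in>FH. v \<in> C \<and> C - {v} \<subseteq> U"
  shows "\<exists>(d::nat) (m::nat). tileable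
    (prod_tiles (prod_tiles F F) (pow_tiles (prod_tiles FH (pow_tiles F {..<d})) {..<m}))
    ((X \<times> X) \<times> ({..<m} \<rightarrow>\<^sub>E H \<times> ({..<d} \<rightarrow>\<^sub>E X)))"
proof -
  obtain e q where XX: "multicover (prod_tiles F F) (X \<times> X) (\<lambda>_. Suc e) (Suc e + q)"
    "multicover (prod_tiles F F) (X \<times> X) (\<lambda>_. e) (e + q)"
    using ex_consecutive_multicovers[OF X covers] by blast
  define d where "d = 2 * (Suc e + q) + q"
  define Y where "Y = {..<d} \<rightarrow>\<^sub>E X"
  define V where "V = (H - U) \<times> Y"
  have H_Y_minus_V: "H \<times> Y - V = U \<times> Y" unfolding V_def using H(2) by blast
  have "\<exists>m::nat. tileable
      (prod_tiles (prod_tiles F F) (pow_tiles (prod_tiles FH (pow_tiles F {..<d})) {..<m}))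
      ((X \<times> X) \<times> ({..<m} \<rightarrow>\<^sub>E H \<times> Y))"
  proof (rule ex_tileable_power[of V])
    show "finite V"
      unfolding V_def Y_def using X H(1) by (intro finite_cartesian_product finite_PiE) auto
    show "V \<subseteq> H \<times> Y" unfolding V_def by blast
    show "tileable (prod_tiles (prod_tiles F F) (prod_tiles FH (pow_tiles F {..<d})))
        ((X \<times> X) \<times> (H \<times> Y - V))"
      unfolding H_Y_minus_V by (intro tileable_Sigma[of "X \<times> X"] tileable_Times H(3))
    fix v assume "v \<in> V"
    then obtain h y where v: "v = (h, y)" "h \<in> H - U" "y \<in> Y" unfolding V_def by blast
    obtain C where "C \<in> FH" "h \<in> C" "C - {h} \<subseteq> U" using H_minus_U[OF v(2)] by blast
    then show "tileable (prod_tiles (prod_tiles F F) (prod_tiles FH (pow_tiles F {..<d})))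
        ((X \<times> X) \<times> (H \<times> Y - V \<union> {v}))"
      unfolding H_Y_minus_V v(1) using v(2,3) unfolding Y_def
      by (intro tileable_absorb_point[OF H(3)] switchable_power[OF XX F d_def]) auto
  qed
  then show ?thesis unfolding Y_def by blast
qed

section \<open>Tiling quotients\<close>

text \<open>Every tiling of \<open>\<Omega>\<close> by \<open>F\<close> pulls back to a tiling of \<open>Z\<close> by \<open>G\<close>.\<close>

definition tiling_quotient :: "'a set \<Rightarrow> 'a set set \<Rightarrow> 'b set \<Rightarrow> 'b set set \<Rightarrow> bool" where
  "tiling_quotient Z G \<Omega> F \<longleftrightarrow> (\<exists>\<pi>\<in>Z \<rightarrow> \<Omega>. \<forall>B\<in>F. B \<subseteq> \<Omega> \<longrightarrow> tileable G {z \<in> Z. \<pi> z \<in> B})"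

lemma tiling_quotientI:
  assumes "\<And>z. z \<in> Z \<Longrightarrow> \<pi> z \<in> \<Omega>" "\<And>B. B \<in> F \<Longrightarrow> B \<subseteq> \<Omega> \<Longrightarrow> tileable G {z \<in> Z. \<pi> z \<in> B}"
  shows "tiling_quotient Z G \<Omega> F"
  using assms unfolding tiling_quotient_def by blast

lemma tiling_quotientE:
  assumes "tiling_quotient Z G \<Omega> F"
  obtains \<pi> where "\<And>z. z \<in> Z \<Longrightarrow> \<pi> z \<in> \<Omega>"
    "\<And>X. tileable F X \<Longrightarrow> X \<subseteq> \<Omega> \<Longrightarrow> tileable G {z \<in> Z. \<pi> z \<in> X}"
proof -
  obtain \<pi> where \<pi>: "\<pi> \<in> Z \<rightarrow> \<Omega>" "\<And>B. B \<in> F \<Longrightarrow> B \<subseteq> \<Omega> \<Longrightarrow> tileable G {z \<in> Z. \<pi> z \<in> B}"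
    using assms unfolding tiling_quotient_def by blast
  show thesis
  proof (rule that)
    show "\<pi> z \<in> \<Omega>" if "z \<in> Z" for z using \<pi>(1) that by blast
    show "tileable G {z \<in> Z. \<pi> z \<in> X}" if "tileable F X" "X \<subseteq> \<Omega>" for X
      using that by (intro tileable_vimage[OF that(1)] \<pi>(2)) auto
  qed
qed

lemma tileable_if_tiling_quotient:
  assumes "tiling_quotient Z G \<Omega> F" "tileable F \<Omega>"
  shows "tileable G Z"
proof -
  obtain \<pi> where \<pi>: "\<And>z. z \<in> Z \<Longrightarrow> \<pi> z \<in> \<Omega>" "tileable G {z \<in> Z. \<pi> z \<in> \<Omega>}"
    using tiling_quotientE[OF assms(1)] assms(2) by (metis subset_refl)
  then have "{z \<in> Z. \<pi> z \<in> \<Omega>} = Z" by blast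
  then show ?thesis using \<pi>(2) by simp
qed

lemma tiling_quotient_trans:
  assumes "tiling_quotient Z G Y H" "tiling_quotient Y H \<Omega> F"
  shows "tiling_quotient Z G \<Omega> F"
proof -
  obtain \<pi> where \<pi>: "\<And>z. z \<in> Z \<Longrightarrow> \<pi> z \<in> Y"
    "\<And>X. tileable H X \<Longrightarrow> X \<subseteq> Y \<Longrightarrow> tileable G {z \<in> Z. \<pi> z \<in> X}"
    using tiling_quotientE[OF assms(1)] by metis
  obtain \<rho> where \<rho>: "\<And>y. y \<in> Y \<Longrightarrow> \<rho> y \<in> \<Omega>"
    "\<And>X. tileable F X \<Longrightarrow> X \<subseteq> \<Omega> \<Longrightarrow> tileable H {y \<in> Y. \<rho> y \<in> X}"
    using tiling_quotientE[OF assms(2)] by metis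
  show ?thesis
  proof (rule tiling_quotientI[where \<pi> = "\<lambda>z. \<rho> (\<pi> z)"])
    fix B assume "B \<in> F" "B \<subseteq> \<Omega>"
    then have "tileable G {z \<in> Z. \<pi> z \<in> {y \<in> Y. \<rho> y \<in> B}}"
      by (intro \<pi>(2) \<rho>(2) tileable_tile) auto
    moreover have "{z \<in> Z. \<pi> z \<in> {y \<in> Y. \<rho> y \<in> B}} = {z \<in> Z. \<rho> (\<pi> z) \<in> B}"
      using \<pi>(1) by blast
    ultimately show "tileable G {z \<in> Z. \<rho> (\<pi> z) \<in> B}" by simp
  qed (use \<pi>(1) \<rho>(1) in blast)
qed

lemma tiling_quotient_prod:
  assumes "tiling_quotient Z1 G1 \<Omega>1 F1" "tiling_quotient Z2 G2 \<Omega>2 F2"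
  shows "tiling_quotient (Z1 \<times> Z2) (prod_tiles G1 G2) (\<Omega>1 \<times> \<Omega>2) (prod_tiles F1 F2)"
proof -
  obtain \<pi>1 where \<pi>1: "\<And>z. z \<in> Z1 \<Longrightarrow> \<pi>1 z \<in> \<Omega>1"
    "\<And>X. tileable F1 X \<Longrightarrow> X \<subseteq> \<Omega>1 \<Longrightarrow> tileable G1 {z \<in> Z1. \<pi>1 z \<in> X}"
    using tiling_quotientE[OF assms(1)] by metis
  obtain \<pi>2 where \<pi>2: "\<And>z. z \<in> Z2 \<Longrightarrow> \<pi>2 z \<in> \<Omega>2"
    "\<And>X. tileable F2 X \<Longrightarrow> X \<subseteq> \<Omega>2 \<Longrightarrow> tileable G2 {z \<in> Z2. \<pi>2 z \<in> X}"
    using tiling_quotientE[OF assms(2)] by metis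
  show ?thesis
  proof (rule tiling_quotientI[where \<pi> = "map_prod \<pi>1 \<pi>2"])
    fix D assume D: "D \<in> prod_tiles F1 F2" "D \<subseteq> \<Omega>1 \<times> \<Omega>2"
    from D(1) show "tileable (prod_tiles G1 G2) {z \<in> Z1 \<times> Z2. map_prod \<pi>1 \<pi>2 z \<in> D}"
    proof (cases rule: prod_tilesE)
      case (left B y)
      have "{z \<in> Z1 \<times> Z2. map_prod \<pi>1 \<pi>2 z \<in> D} = {z \<in> Z1. \<pi>1 z \<in> B} \<times> {z \<in> Z2. \<pi>2 z = y}"
        unfolding left(2) by auto
      moreover have "B \<subseteq> \<Omega>1" using D(2) unfolding left(2) by blast
      ultimately show ?thesis using left(1) by (simp add: tileable_Times \<pi>1(2) tileable_tile)
    next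
      case (right x C)
      have "{z \<in> Z1 \<times> Z2. map_prod \<pi>1 \<pi>2 z \<in> D} = {z \<in> Z1. \<pi>1 z = x} \<times> {z \<in> Z2. \<pi>2 z \<in> C}"
        unfolding right(2) by auto
      moreover have "C \<subseteq> \<Omega>2" using D(2) unfolding right(2) by blast
      ultimately show ?thesis using right(1) by (simp add: tileable_Sigma \<pi>2(2) tileable_tile)
    qed
  qed (use \<pi>1(1) \<pi>2(1) in auto)
qed

lemma tiling_quotient_pow:
  assumes "tiling_quotient Z G \<Omega> F"
  shows "tiling_quotient (I \<rightarrow>\<^sub>E Z) (pow_tiles G I) (I \<rightarrow>\<^sub>E \<Omega>) (pow_tiles F I)"
proof -
  obtain \<pi> where \<pi>: "\<And>z. z \<in> Z \<Longrightarrow> \<pi> z \<in> \<Omega>"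
    "\<And>X. tileable F X \<Longrightarrow> X \<subseteq> \<Omega> \<Longrightarrow> tileable G {z \<in> Z. \<pi> z \<in> X}"
    using tiling_quotientE[OF assms] by metis
  define \<rho> where "\<rho> z = (\<lambda>i\<in>I. \<pi> (z i))" for z
  show ?thesis
  proof (rule tiling_quotientI[where \<pi> = \<rho>])
    fix D assume D: "D \<in> pow_tiles F I" "D \<subseteq> I \<rightarrow>\<^sub>E \<Omega>"
    then obtain f i B where i: "i \<in> I" and B: "B \<in> F" and D_eq: "D = (\<lambda>b. f(i := b)) ` B"
      by (auto elim: pow_tilesE)
    have "B \<subseteq> \<Omega>"
    proof
      fix b assume "b \<in> B"
      then have "f(i := b) \<in> I \<rightarrow>\<^sub>E \<Omega>" using D(2) unfolding D_eq by blast
      from PiE_mem[OF this i] show "b \<in> \<Omega>" by simp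
    qed
    show "tileable (pow_tiles G I) {z \<in> I \<rightarrow>\<^sub>E Z. \<rho> z \<in> D}"
    proof (rule tileable_lines[where dir = "\<lambda>_. i"])
      fix z assume "z \<in> {z \<in> I \<rightarrow>\<^sub>E Z. \<rho> z \<in> D}"
      then obtain b where z: "z \<in> I \<rightarrow>\<^sub>E Z" and b: "\<rho> z = f(i := b)" unfolding D_eq by blast
      have "z(i := x) \<in> I \<rightarrow>\<^sub>E Z \<longleftrightarrow> x \<in> Z" for x
        using z i by (auto simp: PiE_iff extensional_def split: if_splits)
      moreover have "\<rho> (z(i := x)) \<in> D \<longleftrightarrow> \<pi> x \<in> B" for x
      proof -
        have "\<rho> (z(i := x)) = (\<rho> z)(i := \<pi> x)" using i by (auto simp: \<rho>_def)
        then have "\<rho> (z(i := x)) = f(i := \<pi> x)" using b by simp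
        then show ?thesis
          unfolding D_eq using inj_image_mem_iff[OF inj_on_fun_upd[of f i UNIV]] by simp
      qed
      ultimately have "{x. z(i := x) \<in> {z \<in> I \<rightarrow>\<^sub>E Z. \<rho> z \<in> D} \<and> i = i} = {x \<in> Z. \<pi> x \<in> B}"
        by simp
      then show "tileable G {x. z(i := x) \<in> {z \<in> I \<rightarrow>\<^sub>E Z. \<rho> z \<in> D} \<and> i = i}"
        using \<pi>(2)[OF tileable_tile[OF B] \<open>B \<subseteq> \<Omega>\<close>] by simp
    qed (rule i)
  qed (use \<pi>(1) in \<open>auto simp: \<rho>_def\<close>)
qed

lemma tiling_quotient_bij:
  assumes bij: "bij_betw \<rho> \<Omega> Z" and "\<And>B. B \<in> F \<Longrightarrow> B \<subseteq> \<Omega> \<Longrightarrow> \<rho> ` B \<in> G"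
  shows "tiling_quotient Z G \<Omega> F"
proof (rule tiling_quotientI[where \<pi> = "inv_into \<Omega> \<rho>"])
  show "inv_into \<Omega> \<rho> z \<in> \<Omega>" if "z \<in> Z" for z
    using bij that by (metis bij_betw_imp_surj_on inv_into_into)
  fix B assume B: "B \<in> F" "B \<subseteq> \<Omega>"
  have "{z \<in> Z. inv_into \<Omega> \<rho> z \<in> B} = \<rho> ` B"
  proof (intro equalityI subsetI)
    fix z assume "z \<in> {z \<in> Z. inv_into \<Omega> \<rho> z \<in> B}"
    then show "z \<in> \<rho> ` B"
      using bij_betw_inv_into_right[OF bij, of z]
      by (intro image_eqI[of z \<rho> "inv_into \<Omega> \<rho> z"]) simp_all
  next
    fix z assume "z \<in> \<rho> ` B"
    then show "z \<in> {z \<in> Z. inv_into \<Omega> \<rho> z \<in> B}"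
      using bij B(2) bij_betw_inv_into_left[OF bij] by (auto dest: bij_betwE)
  qed
  then show "tileable G {z \<in> Z. inv_into \<Omega> \<rho> z \<in> B}"
    using assms(2)[OF B] by (simp add: tileable_tile)
qed

lemma tiling_quotient_power_reindex:
  assumes "bij_betw e I J"
  shows "tiling_quotient (J \<rightarrow>\<^sub>E X) (pow_tiles G J) (I \<rightarrow>\<^sub>E X) (pow_tiles G I)"
proof (rule tiling_quotient_bij)
  define e' where "e' = inv_into I e"
  have e: "e i \<in> J" "e' (e i) = i" if "i \<in> I" for i
    using assms that by (auto simp: e'_def bij_betw_inv_into_left dest: bij_betwE)
  have e': "e' j \<in> I" "e (e' j) = j" if "j \<in> J" for j
    using assms that
    by (auto simp: e'_def bij_betw_inv_into_right bij_betw_imp_surj_on intro: inv_into_into)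
  show "bij_betw (\<lambda>x. \<lambda>j\<in>J. x (e' j)) (I \<rightarrow>\<^sub>E X) (J \<rightarrow>\<^sub>E X)"
    by (rule bij_betw_byWitness[where f' = "\<lambda>z. \<lambda>i\<in>I. z (e i)"])
      (use e e' in \<open>auto simp: fun_eq_iff PiE_iff extensional_def\<close>)
  fix D assume "D \<in> pow_tiles G I"
  then obtain f i B where D: "i \<in> I" "B \<in> G" "D = (\<lambda>b. f(i := b)) ` B" by (rule pow_tilesE)
  have "(\<lambda>j\<in>J. (f(i := b)) (e' j)) = (\<lambda>j\<in>J. f (e' j))(e i := b)" for b
    using e e' D(1) by (auto simp: fun_eq_iff)
  then have "(\<lambda>x. \<lambda>j\<in>J. x (e' j)) ` D = (\<lambda>b. (\<lambda>j\<in>J. f (e' j))(e i := b)) ` B"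
    unfolding D(3) image_image by simp
  then show "(\<lambda>x. \<lambda>j\<in>J. x (e' j)) ` D \<in> pow_tiles G J"
    using D(2) e(1)[OF D(1)] unfolding pow_tiles_def by blast
qed

lemma tiling_quotient_power_singleton:
  "tiling_quotient ({i} \<rightarrow>\<^sub>E X) (pow_tiles G {i}) X G"
proof (rule tiling_quotient_bij)
  show "bij_betw (\<lambda>x. \<lambda>_\<in>{i}. x) X ({i} \<rightarrow>\<^sub>E X)"
    by (rule bij_betw_byWitness[where f' = "\<lambda>z. z i"])
      (auto simp: fun_eq_iff PiE_iff extensional_def split: if_splits)
  fix B assume "B \<in> G"
  moreover have "(\<lambda>x. \<lambda>_\<in>{i}. x) ` B = (\<lambda>b. (\<lambda>_. undefined)(i := b)) ` B"
    by (intro image_cong) (auto simp: fun_eq_iff)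
  ultimately show "(\<lambda>x. \<lambda>_\<in>{i}. x) ` B \<in> pow_tiles G {i}"
    unfolding pow_tiles_def by blast
qed

lemma tiling_quotient_power_Plus:
  "tiling_quotient ((I <+> J) \<rightarrow>\<^sub>E X) (pow_tiles G (I <+> J))
    ((I \<rightarrow>\<^sub>E X) \<times> (J \<rightarrow>\<^sub>E X)) (prod_tiles (pow_tiles G I) (pow_tiles G J))"
proof (rule tiling_quotient_bij)
  show "bij_betw (\<lambda>(x, y). case_sum x y) ((I \<rightarrow>\<^sub>E X) \<times> (J \<rightarrow>\<^sub>E X)) ((I <+> J) \<rightarrow>\<^sub>E X)"
    by (rule bij_betw_byWitness[where f' = "\<lambda>z. (\<lambda>i. z (Inl i), \<lambda>j. z (Inr j))"])
      (auto simp: fun_eq_iff PiE_iff extensional_def split: sum.splits)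
  fix D assume "D \<in> prod_tiles (pow_tiles G I) (pow_tiles G J)"
  then show "(\<lambda>(x, y). case_sum x y) ` D \<in> pow_tiles G (I <+> J)"
  proof (cases rule: prod_tilesE)
    case (left L y)
    then obtain f i B where L: "i \<in> I" "B \<in> G" "L = (\<lambda>b. f(i := b)) ` B" by (auto elim: pow_tilesE)
    have "case_sum (f(i := b)) y = (case_sum f y)(Inl i := b)" for b
      by (auto simp: fun_eq_iff split: sum.splits)
    moreover have "D = (\<lambda>b. (f(i := b), y)) ` B" unfolding left(2) L(3) by auto
    ultimately have "(\<lambda>(x, y). case_sum x y) ` D = (\<lambda>b. (case_sum f y)(Inl i := b)) ` B"
      by (simp add: image_image)
    then show ?thesis using L(1,2) unfolding pow_tiles_def by blast
  next
    case (right x L)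
    then obtain f j B where L: "j \<in> J" "B \<in> G" "L = (\<lambda>b. f(j := b)) ` B" by (auto elim: pow_tilesE)
    have "case_sum x (f(j := b)) = (case_sum x f)(Inr j := b)" for b
      by (auto simp: fun_eq_iff split: sum.splits)
    moreover have "D = (\<lambda>b. (x, f(j := b))) ` B" unfolding right(2) L(3) by auto
    ultimately have "(\<lambda>(x, y). case_sum x y) ` D = (\<lambda>b. (case_sum x f)(Inr j := b)) ` B"
      by (simp add: image_image)
    then show ?thesis using L(1,2) unfolding pow_tiles_def by blast
  qed
qed

lemma tiling_quotient_power_Times:
  "tiling_quotient ((M \<times> I) \<rightarrow>\<^sub>E X) (pow_tiles G (M \<times> I))
    (M \<rightarrow>\<^sub>E (I \<rightarrow>\<^sub>E X)) (pow_tiles (pow_tiles G I) M)"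
proof (rule tiling_quotient_bij)
  let ?\<rho> = "\<lambda>g. \<lambda>p\<in>M \<times> I. g (fst p) (snd p)"
  show "bij_betw ?\<rho> (M \<rightarrow>\<^sub>E (I \<rightarrow>\<^sub>E X)) ((M \<times> I) \<rightarrow>\<^sub>E X)"
    by (rule bij_betw_byWitness[where f' = "\<lambda>z. \<lambda>m\<in>M. \<lambda>i\<in>I. z (m, i)"])
      (auto simp: fun_eq_iff PiE_iff extensional_def split: if_splits)
  fix D assume "D \<in> pow_tiles (pow_tiles G I) M"
  then obtain g m f i B where D: "m \<in> M" "i \<in> I" "B \<in> G" "D = (\<lambda>l. g(m := l)) ` (\<lambda>b. f(i := b)) ` B"
    by (auto elim!: pow_tilesE)
  have "?\<rho> (g(m := f(i := b))) = (?\<rho> (g(m := f)))((m, i) := b)" for b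
    using D(1,2) by (auto simp: fun_eq_iff)
  then have "?\<rho> ` D = (\<lambda>b. (?\<rho> (g(m := f)))((m, i) := b)) ` B"
    unfolding D(4) image_image by simp
  then show "?\<rho> ` D \<in> pow_tiles G (M \<times> I)"
    using D(1-3) unfolding pow_tiles_def by blast
qed

lemma tiling_quotient_power_prod:
  assumes "tiling_quotient (I \<rightarrow>\<^sub>E X) (pow_tiles G I) \<Omega>1 F1"
    and "tiling_quotient (J \<rightarrow>\<^sub>E X) (pow_tiles G J) \<Omega>2 F2"
  shows "tiling_quotient ((I <+> J) \<rightarrow>\<^sub>E X) (pow_tiles G (I <+> J)) (\<Omega>1 \<times> \<Omega>2) (prod_tiles F1 F2)"
  using tiling_quotient_trans[OF tiling_quotient_power_Plus tiling_quotient_prod[OF assms]] .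

lemma tiling_quotient_power_pow:
  assumes "tiling_quotient (I \<rightarrow>\<^sub>E X) (pow_tiles G I) \<Omega> F"
  shows "tiling_quotient ((M \<times> I) \<rightarrow>\<^sub>E X) (pow_tiles G (M \<times> I)) (M \<rightarrow>\<^sub>E \<Omega>) (pow_tiles F M)"
  using tiling_quotient_trans[OF tiling_quotient_power_Times tiling_quotient_pow[OF assms]] .

definition translates :: "'a::plus set \<Rightarrow> 'a set \<Rightarrow> 'a set set" where
  "translates X T = (\<lambda>x. (+) x ` T) ` X"

text \<open>The tiles consist of the shifts of the points over \<open>x\<close>.\<close>

lemma tileable_vimage_shifts:
  assumes shift: "\<And>t. t \<in> T \<Longrightarrow> bij_betw (\<sigma> t) Z Z" and \<tau>: "inj_on \<tau> T"
    and \<pi>: "\<And>z t. z \<in> Z \<Longrightarrow> t \<in> T \<Longrightarrow> \<pi> (\<sigma> t z) = \<tau> t \<longleftrightarrow> \<pi> z = x"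
    and G: "\<And>z. z \<in> Z \<Longrightarrow> (\<lambda>t. \<sigma> t z) ` T \<in> G"
  shows "tileable G {z \<in> Z. \<pi> z \<in> \<tau> ` T}"
proof -
  let ?Z = "{z \<in> Z. \<pi> z = x}"
  have "tileable G (\<Union>z\<in>?Z. (\<lambda>t. \<sigma> t z) ` T)"
  proof (rule tileable_UN)
    show "disjoint_family_on (\<lambda>z. (\<lambda>t. \<sigma> t z) ` T) ?Z"
      unfolding disjoint_family_on_def
    proof (intro ballI impI Int_emptyI)
      fix z z' w assume z: "z \<in> ?Z" "z' \<in> ?Z" "z \<noteq> z'"
        and "w \<in> (\<lambda>t. \<sigma> t z) ` T" "w \<in> (\<lambda>t. \<sigma> t z') ` T"
      then obtain t t' where t: "t \<in> T" "t' \<in> T" "\<sigma> t z = \<sigma> t' z'" by blast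
      then have "\<tau> t = \<tau> t'" using z \<pi>[of z t] \<pi>[of z' t'] by auto
      then have "t = t'" using \<tau> t by (auto dest: inj_onD)
      then show False
        using z t shift[of t] by (auto dest!: bij_betw_imp_inj_on inj_onD)
    qed
  qed (use G in \<open>auto intro: tileable_tile\<close>)
  moreover have "(\<Union>z\<in>?Z. (\<lambda>t. \<sigma> t z) ` T) = {z \<in> Z. \<pi> z \<in> \<tau> ` T}"
  proof (intro equalityI subsetI)
    fix w assume "w \<in> {z \<in> Z. \<pi> z \<in> \<tau> ` T}"
    then obtain t where t: "w \<in> Z" "t \<in> T" "\<pi> w = \<tau> t" by blast
    then obtain z where "z \<in> Z" "w = \<sigma> t z"
      using bij_betw_imp_surj_on[OF shift[OF t(2)]] by blast
    then show "w \<in> (\<Union>z\<in>?Z. (\<lambda>t. \<sigma> t z) ` T)" using t \<pi>[of z t] by auto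
  qed (use shift \<pi> in \<open>auto dest: bij_betwE\<close>)
  ultimately show ?thesis by simp
qed

lemma bij_betw_add_right:
  fixes Z :: "'a::group_add set"
  assumes "\<And>z. z \<in> Z \<Longrightarrow> z + t \<in> Z" "\<And>z. z \<in> Z \<Longrightarrow> z - t \<in> Z"
  shows "bij_betw (\<lambda>z. z + t) Z Z"
  by (rule bij_betw_byWitness[where f' = "\<lambda>z. z - t"]) (use assms in auto)

lemma tiling_quotient_additive:
  fixes \<phi> :: "'a::group_add \<Rightarrow> 'b::group_add"
  assumes \<phi>: "\<And>x y. \<phi> (x + y) = \<phi> x + \<phi> y" "inj_on \<phi> T"
    and Z: "\<And>z t. z \<in> Z \<Longrightarrow> t \<in> T \<Longrightarrow> z + t \<in> Z" "\<And>z t. z \<in> Z \<Longrightarrow> t \<in> T \<Longrightarrow> z - t \<in> Z"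
  shows "tiling_quotient Z (translates Z T) UNIV (translates UNIV (\<phi> ` T))"
proof (rule tiling_quotientI[where \<pi> = \<phi>])
  fix B assume "B \<in> translates UNIV (\<phi> ` T)"
  then obtain u where B: "B = (\<lambda>t. u + \<phi> t) ` T"
    unfolding translates_def by (auto simp: image_image)
  show "tileable (translates Z T) {z \<in> Z. \<phi> z \<in> B}"
    unfolding B
  proof (rule tileable_vimage_shifts[where \<sigma> = "\<lambda>t z. z + t"])
    show "bij_betw (\<lambda>z. z + t) Z Z" if "t \<in> T" for t
      using Z that by (intro bij_betw_add_right) auto
    show "inj_on (\<lambda>t. u + \<phi> t) T" using \<phi>(2) by (simp add: inj_on_def)
    show "\<phi> (z + t) = u + \<phi> t \<longleftrightarrow> \<phi> z = u" for z t by (simp add: \<phi>(1))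
  qed (simp add: translates_def)
qed simp

section \<open>Coverings of a cyclic group\<close>

text \<open>For \<open>0 \<in> A\<close> this solves \<open>(\<Sum>a\<in>A. w (n - a)) = 1\<close>, where \<open>w\<close> vanishes on negative arguments.\<close>

fun unit_weight :: "nat set \<Rightarrow> nat \<Rightarrow> int" where
  "unit_weight A n = 1 - (\<Sum>a\<in>A \<inter> {1..n}. unit_weight A (n - a))"

declare unit_weight.simps [simp del]

lemma sum_unit_weight:
  assumes "0 \<in> A"
  shows "(\<Sum>a\<in>A \<inter> {..n}. unit_weight A (n - a)) = 1"
proof -
  have "A \<inter> {..n} = insert 0 (A \<inter> {1..n})" using assms by auto
  then show ?thesis by (simp add: unit_weight.simps[of A n])
qed

lemma recurrence_eventually_periodic:
  fixes w :: "nat \<Rightarrow> 'a"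
  assumes "finite (range w)"
    and recurrence: "\<And>m n. (\<And>i. i < D \<Longrightarrow> w (m + i) = w (n + i)) \<Longrightarrow> w (m + D) = w (n + D)"
  shows "\<exists>p>0. \<exists>m. \<forall>n\<ge>m. w (n + p) = w n"
proof -
  define window where "window n = map (\<lambda>i. w (n + i)) [0..<D]" for n
  have "range window \<subseteq> {xs. set xs \<subseteq> range w \<and> length xs = D}"
    unfolding window_def by auto
  then have "finite (range window)"
    using finite_lists_length_eq[OF assms(1)] finite_subset by blast
  then have "\<not> inj window" using finite_imageD infinite_UNIV_nat by blast
  then obtain m p where p: "p > 0" "window m = window (m + p)"
    unfolding inj_def by (metis less_imp_add_positive linorder_neqE_nat)
  have "w (m + i) = w (m + p + i)" for i
  proof (induction i rule: less_induct)
    case (less i)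
    show ?case
    proof (cases "i < D")
      case True
      then show ?thesis using arg_cong[OF p(2), of "\<lambda>xs. xs ! i"] by (simp add: window_def)
    next
      case False
      have "w (m + (i - D) + l) = w (m + p + (i - D) + l)" if "l < D" for l
        using less.IH[of "i - D + l"] that False by (simp add: add.assoc)
      then have "w (m + (i - D) + D) = w (m + p + (i - D) + D)" by (rule recurrence)
      then show ?thesis using False by (simp add: add.assoc)
    qed
  qed
  then have "\<forall>n\<ge>m. w (n + p) = w n"
    by (metis add.commute add.left_commute le_Suc_ex)
  then show ?thesis using p(1) by blast
qed

lemma ex_periodic_extension:
  fixes w :: "nat \<Rightarrow> 'a"
  assumes "p > 0" "\<And>n. n \<ge> m \<Longrightarrow> w (n + p) = w n"
  shows "\<exists>W :: int \<Rightarrow> 'a. (\<forall>x. W (x mod int p) = W x) \<and> (\<forall>n\<ge>m. W (int n) = w n)"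
proof -
  define W where "W x = w (m + nat ((x - int m) mod int p))" for x
  have period: "w (m + i + p * t) = w (m + i)" for i t
  proof (induction t)
    case (Suc t)
    have "m + i + p * Suc t = m + i + p * t + p" by simp
    also have "w \<dots> = w (m + i + p * t)" by (rule assms(2)) simp
    finally show ?case using Suc by simp
  qed simp
  have "W (int n) = w n" if "n \<ge> m" for n
  proof -
    define i where "i = n - m"
    have i: "n = m + i" using that by (simp add: i_def)
    have "w n = w (m + i mod p + p * (i div p))" by (simp add: i add.assoc)
    also have "\<dots> = W (int n)" unfolding period by (simp add: W_def i flip: zmod_int)
    finally show ?thesis by simp
  qed
  moreover have "W (x mod int p) = W x" for x
    unfolding W_def by (simp add: mod_diff_left_eq)
  ultimately show ?thesis by blast
qed

lemma unit_weight_mod_eventually_periodic: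
  assumes A: "A \<subseteq> {..D}" and k: "k > 0"
  shows "\<exists>p>0. \<exists>m. \<forall>n\<ge>m. unit_weight A (n + p) mod int k = unit_weight A n mod int k"
proof -
  define v where "v n = unit_weight A n mod int k" for n
  have v: "v (n + D) = (1 - (\<Sum>a\<in>A - {0}. v (n + D - a))) mod int k" for n
  proof -
    have "A \<inter> {1..n + D} = A - {0}" using A by auto
    then show ?thesis
      unfolding v_def by (subst unit_weight.simps) (simp, metis mod_diff_right_eq mod_sum_eq)
  qed
  have "\<exists>p>0. \<exists>m. \<forall>n\<ge>m. v (n + p) = v n"
  proof (rule recurrence_eventually_periodic)
    have "range v \<subseteq> {0..<int k}" using k by (auto simp: v_def)
    then show "finite (range v)" by (rule finite_subset) simp
    fix m n assume window: "\<And>i. i < D \<Longrightarrow> v (m + i) = v (n + i)"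
    have "v (m + D - a) = v (n + D - a)" if "a \<in> A - {0}" for a
      using window[of "D - a"] that A by fastforce
    then show "v (m + D) = v (n + D)" unfolding v by simp
  qed
  then show ?thesis unfolding v_def .
qed

lemma periodic_extension_window:
  fixes W :: "int \<Rightarrow> 'a"
  assumes p: "p > 0" and W: "\<And>x. W (x mod int p) = W x" "\<And>n. n \<ge> m \<Longrightarrow> W (int n) = w n"
  shows "\<exists>n\<ge>D. \<forall>a\<le>D. W (x - int a) = w (n - a)"
proof -
  define n where "n = nat (x mod int p) + p * (m + D)"
  have n_ge: "m + D \<le> n"
  proof -
    have "1 * (m + D) \<le> p * (m + D)" using p by (intro mult_le_mono1) simp
    then show ?thesis unfolding n_def by (simp only: mult_1 trans_le_add2)
  qed
  have "W (x - int a) = w (n - a)" if a: "a \<le> D" for a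
  proof -
    have "[int n = x] (mod int p)" using p by (simp add: n_def cong_def)
    then have "[x - int a = int n - int a] (mod int p)" by (simp add: cong_diff cong_sym)
    then have "W (x - int a) = W (int n - int a)" using W(1) by (metis cong_def)
    also have "int n - int a = int (n - a)" using a n_ge by simp
    also have "W (int (n - a)) = w (n - a)" using a n_ge by (intro W(2)) simp
    finally show ?thesis .
  qed
  then show ?thesis using n_ge by (intro exI[of _ n]) simp
qed

lemma ex_periodic_weight:
  assumes A: "A \<subseteq> {..D}" "0 \<in> A" and k: "k > 0"
  shows "\<exists>p>0. \<exists>w :: int \<Rightarrow> nat. \<forall>x. w (x mod int p) = w x
    \<and> [\<Sum>a\<in>A. w (x - int a) = 1] (mod k)"
proof -
  let ?v = "\<lambda>n. unit_weight A n mod int k"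
  obtain p m where p: "p > 0" "\<And>n. n \<ge> m \<Longrightarrow> ?v (n + p) = ?v n"
    using unit_weight_mod_eventually_periodic[OF A(1) k] by blast
  obtain W where W: "\<And>x. W (x mod int p) = W x" "\<And>n. n \<ge> m \<Longrightarrow> W (int n) = ?v n"
    using ex_periodic_extension[where w = ?v, OF p] by blast
  have "[\<Sum>a\<in>A. nat (W (x - int a)) = 1] (mod k)" for x
  proof -
    obtain n where n: "n \<ge> D" "\<And>a. a \<le> D \<Longrightarrow> W (x - int a) = ?v (n - a)"
      using periodic_extension_window[where w = ?v, OF p(1) W] by blast
    have "int (\<Sum>a\<in>A. nat (W (x - int a))) = (\<Sum>a\<in>A. ?v (n - a))"
      unfolding of_nat_sum using A(1) n(2) k by (intro sum.cong) auto
    moreover have "(\<Sum>a\<in>A. unit_weight A (n - a)) = 1"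
    proof -
      have "A \<inter> {..n} = A" using A(1) n(1) by auto
      then show ?thesis using sum_unit_weight[OF A(2), of n] by simp
    qed
    ultimately have "[int (\<Sum>a\<in>A. nat (W (x - int a))) = int 1] (mod k)"
      by (simp add: cong_def mod_sum_eq)
    then show ?thesis by (simp only: cong_int_iff)
  qed
  then show ?thesis using p(1) W(1) by (intro exI[of _ p] conjI exI[of _ "\<lambda>x. nat (W x)"]) auto
qed

definition cyclic_tile :: "nat set \<Rightarrow> int \<Rightarrow> int \<Rightarrow> int set" where
  "cyclic_tile A N u = (\<lambda>a. (u + int a) mod N) ` A"

definition cyclic_tiles :: "nat set \<Rightarrow> int \<Rightarrow> int set set" where
  "cyclic_tiles A N = range (cyclic_tile A N)"

lemma cyclic_tile_subset: "N > 0 \<Longrightarrow> cyclic_tile A N u \<subseteq> {0..<N}"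
  by (auto simp: cyclic_tile_def)

lemma inj_on_int_mod:
  assumes "A \<subseteq> {..D}" "int D < N"
  shows "inj_on (\<lambda>a. int a mod N) A"
proof (rule inj_on_cong[THEN iffD2])
  show "int a mod N = int a" if "a \<in> A" for a
    using that assms by (intro mod_pos_pos_trivial) force+
qed (simp add: inj_on_def)

lemma inj_on_add_mod:
  assumes "A \<subseteq> {..D}" "int D < N"
  shows "inj_on (\<lambda>a. (u + int a) mod N) A"
proof (rule inj_onI)
  fix a b assume ab: "a \<in> A" "b \<in> A" and "(u + int a) mod N = (u + int b) mod N"
  then have "[int a = int b] (mod N)" by (metis cong_add_lcancel cong_def)
  then show "a = b" using inj_onD[OF inj_on_int_mod[OF assms] _ ab] by (simp add: cong_def)
qed

lemma inj_on_diff_mod: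
  assumes "A \<subseteq> {..D}" "int D < N"
  shows "inj_on (\<lambda>a. (x - int a) mod N) A"
proof (rule inj_onI)
  fix a b assume ab: "a \<in> A" "b \<in> A" and "(x - int a) mod N = (x - int b) mod N"
  then have "[x - int a = x - int b] (mod N)" by (simp only: cong_def)
  from cong_diff[OF cong_refl[of x] this] have "[int a = int b] (mod N)" by simp
  then show "a = b" using inj_onD[OF inj_on_int_mod[OF assms] _ ab] by (simp add: cong_def)
qed

lemma multicover_cyclic:
  assumes A: "A \<subseteq> {..D}" and N: "int D < N" and w: "\<And>x. w (x mod N) = w x"
  shows "multicover (cyclic_tiles A N) {0..<N} (\<lambda>x. \<Sum>a\<in>A. w (x - int a)) (\<Sum>u\<in>{0..<N}. w u)"
proof -
  have coverage: "(\<Sum>u\<in>{0..<N}. w u * of_bool (x \<in> cyclic_tile A N u)) = (\<Sum>a\<in>A. w (x - int a))"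
    if x: "x \<in> {0..<N}" for x
  proof -
    have mem: "x \<in> cyclic_tile A N u \<longleftrightarrow> u \<in> (\<lambda>a. (x - int a) mod N) ` A" if "u \<in> {0..<N}" for u
    proof -
      have "x = (u + int a) mod N \<longleftrightarrow> u = (x - int a) mod N" for a
      proof
        assume "x = (u + int a) mod N"
        then show "u = (x - int a) mod N" using that by (simp add: mod_diff_left_eq)
      next
        assume "u = (x - int a) mod N"
        then show "x = (u + int a) mod N" using x by (simp add: mod_add_left_eq)
      qed
      then show ?thesis by (auto simp: cyclic_tile_def)
    qed
    have "(\<Sum>u\<in>{0..<N}. w u * of_bool (x \<in> cyclic_tile A N u))
        = (\<Sum>u\<in>(\<lambda>a. (x - int a) mod N) ` A. w u)"
      using N mem by (intro sum.mono_neutral_cong_right) auto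
    also have "\<dots> = (\<Sum>a\<in>A. w (x - int a))"
      using w by (simp add: sum.reindex[OF inj_on_diff_mod[OF A N]])
    finally show ?thesis .
  qed
  have "multicover (cyclic_tiles A N) {0..<N}
      (\<lambda>x. \<Sum>u\<in>{0..<N}. w u * of_bool (x \<in> cyclic_tile A N u)) (\<Sum>u\<in>{0..<N}. w u * 1)"
    using N cyclic_tile_subset[of N]
    by (intro multicover_sum multicover_scale multicover_tile) (auto simp: cyclic_tiles_def)
  from multicover_cong[THEN iffD1, OF coverage this] show ?thesis by simp
qed

lemma ex_cyclic_multicover:
  assumes A: "A \<subseteq> {..D}" "0 \<in> A"
  shows "\<exists>N>int D. \<exists>c s.
    multicover (cyclic_tiles A N) {0..<N} (\<lambda>x. Suc (card A * c x)) s"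
proof -
  have card: "card A > 0" using A finite_subset[OF A(1)] by (auto simp: card_gt_0_iff)
  obtain p w where p: "p > 0" and w: "\<And>x. w (x mod int p) = w x"
    "\<And>x. [\<Sum>a\<in>A. w (x - int a) = 1] (mod card A)"
    using ex_periodic_weight[OF A card] by blast
  define N where "N = int p * (int D + 1)"
  have N: "int D < N"
  proof -
    have "1 * (int D + 1) \<le> N" unfolding N_def using p by (intro mult_right_mono) auto
    then show ?thesis by simp
  qed
  have "\<exists>c. (\<Sum>a\<in>A. 1 + w (x - int a)) = Suc (card A * c)" for x
  proof -
    have "(\<Sum>a\<in>A. 1 + w (x - int a)) = card A + (\<Sum>a\<in>A. w (x - int a))"
      by (subst sum.distrib) simp
    then have "[\<Sum>a\<in>A. 1 + w (x - int a) = 1] (mod card A)"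
      using w(2)[of x] by (simp add: cong_def)
    moreover have "(\<Sum>a\<in>A. 1 + w (x - int a)) \<noteq> 0"
      using card by (subst sum.distrib) simp
    ultimately show ?thesis
      using cong_to_1'_nat by (metis add.commute mult.commute plus_1_eq_Suc)
  qed
  then obtain c where "\<And>x. (\<Sum>a\<in>A. 1 + w (x - int a)) = Suc (card A * c x)" by metis
  moreover have "1 + w (x mod N) = 1 + w x" for x
    using w(1)[of "x mod N"] w(1)[of x] by (simp add: N_def mod_mod_cancel)
  ultimately show ?thesis
    using multicover_cyclic[OF A(1) N, of "\<lambda>x. 1 + w x"] N by auto
qed

lemma tiling_quotient_cyclic:
  assumes "A \<subseteq> {..D}" "int D < N"
  shows "tiling_quotient UNIV (translates UNIV (int ` A)) {0..<N} (cyclic_tiles A N)"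
proof (rule tiling_quotientI[where \<pi> = "\<lambda>z. z mod N"])
  fix B assume "B \<in> cyclic_tiles A N"
  then obtain u where B: "B = (\<lambda>a. (u + int a) mod N) ` A"
    unfolding cyclic_tiles_def cyclic_tile_def by blast
  show "tileable (translates UNIV (int ` A)) {z \<in> UNIV. z mod N \<in> B}"
    unfolding B
  proof (rule tileable_vimage_shifts[where \<sigma> = "\<lambda>a z. z + int a"])
    show "inj_on (\<lambda>a. (u + int a) mod N) A" by (rule inj_on_add_mod[OF assms])
    show "(z + int a) mod N = (u + int a) mod N \<longleftrightarrow> z mod N = u mod N" for z a
      using cong_add_rcancel[of z "int a" u N] by (simp add: cong_def)
  qed (auto simp: translates_def image_image intro: bij_betw_add_right)
qed (use assms(2) in auto)

section \<open>Affine tiles over a prime field\<close>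

text \<open>The coordinates are indexed by \<open>A\<close> itself, so that the point of the tile with parameter \<open>a\<close> can
  be prescribed in coordinate \<open>a\<close>.\<close>

definition affine_tile :: "nat set \<Rightarrow> int \<Rightarrow> (nat \<Rightarrow> int) \<Rightarrow> (nat \<Rightarrow> int) \<Rightarrow> (nat \<Rightarrow> int) set" where
  "affine_tile A M y h = (\<lambda>a. \<lambda>j\<in>A. (y j + int a * h j) mod M) ` A"

definition directions :: "nat set \<Rightarrow> int \<Rightarrow> (nat \<Rightarrow> int) set" where
  "directions A M = {h \<in> A \<rightarrow>\<^sub>E {0..<M}. \<exists>j\<in>A. h j \<noteq> 0}"

lemma finite_directions: "finite A \<Longrightarrow> finite (directions A M)"
  using finite_PiE[of A "\<lambda>_. {0..<M}"] by (simp add: directions_def)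

definition affine_tiles :: "nat set \<Rightarrow> int \<Rightarrow> (nat \<Rightarrow> int) set set" where
  "affine_tiles A M = {affine_tile A M y h | y h. h \<in> directions A M}"

definition affine_core :: "nat set \<Rightarrow> int \<Rightarrow> (nat \<Rightarrow> int) set" where
  "affine_core A M = {y \<in> A \<rightarrow>\<^sub>E {0..<M}. \<exists>j\<in>A. y j \<in> int ` A}"

lemma restrict_mod_eq_iff:
  fixes f g :: "'a \<Rightarrow> int"
  shows "(\<lambda>j\<in>A. f j mod M) = (\<lambda>j\<in>A. g j mod M) \<longleftrightarrow> (\<forall>j\<in>A. [f j = g j] (mod M))"
  by (auto simp: fun_eq_iff cong_def)

lemma inj_on_affine:
  assumes A: "A \<subseteq> {..D}" and M: "prime M" "int D < M" and h: "h \<in> directions A M"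
  shows "inj_on (\<lambda>a. \<lambda>j\<in>A. (y j + int a * h j) mod M) A"
proof (rule inj_onI)
  fix a b assume ab: "a \<in> A" "b \<in> A"
    and "(\<lambda>j\<in>A. (y j + int a * h j) mod M) = (\<lambda>j\<in>A. (y j + int b * h j) mod M)"
  then have eq: "[y j + int a * h j = y j + int b * h j] (mod M)" if "j \<in> A" for j
    using that by (simp only: restrict_mod_eq_iff)
  obtain j where j: "j \<in> A" "0 < h j" "h j < M"
    using h by (force simp: directions_def)
  have "\<not> M dvd h j" using j zdvd_not_zless by blast
  then have "coprime (h j) M" using M(1) by (simp add: coprime_commute prime_imp_coprime)
  then have "[int a = int b] (mod M)"
    using eq[OF j(1)] by (simp add: cong_add_lcancel cong_mult_rcancel)
  then show "a = b"
    using inj_onD[OF inj_on_int_mod[OF A M(2)] _ ab] by (simp add: cong_def)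
qed

lemma tiling_quotient_affine:
  assumes A: "A \<subseteq> {..D}" and M: "prime M" "int D < M"
  shows "tiling_quotient
    (directions A M \<rightarrow>\<^sub>E UNIV) (pow_tiles (translates UNIV (int ` A)) (directions A M))
    (A \<rightarrow>\<^sub>E {0..<M}) (affine_tiles A M)"
proof -
  let ?I = "directions A M"
  have fin: "finite ?I"
    using finite_subset[OF A] by (simp add: finite_directions)
  define \<pi> where "\<pi> z = (\<lambda>j\<in>A. (\<Sum>h\<in>?I. z h * h j) mod M)" for z :: "(nat \<Rightarrow> int) \<Rightarrow> int"
  show ?thesis
  proof (rule tiling_quotientI[where \<pi> = \<pi>])
    show "\<pi> z \<in> A \<rightarrow>\<^sub>E {0..<M}" for z
      using prime_gt_0_int[OF M(1)] by (auto simp: \<pi>_def)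
    fix B assume "B \<in> affine_tiles A M"
    then obtain y h where B: "B = (\<lambda>a. \<lambda>j\<in>A. (y j + int a * h j) mod M) ` A" and h: "h \<in> ?I"
      unfolding affine_tiles_def affine_tile_def by blast
    show "tileable (pow_tiles (translates UNIV (int ` A)) ?I) {z \<in> ?I \<rightarrow>\<^sub>E UNIV. \<pi> z \<in> B}"
      unfolding B
    proof (rule tileable_vimage_shifts[where \<sigma> = "\<lambda>a z. z(h := z h + int a)"])
      show "bij_betw (\<lambda>z. z(h := z h + int a)) (?I \<rightarrow>\<^sub>E UNIV) (?I \<rightarrow>\<^sub>E UNIV)" for a
        by (rule bij_betw_byWitness[where f' = "\<lambda>z. z(h := z h - int a)"])
          (use h in \<open>auto simp: PiE_iff extensional_def\<close>)
      show "inj_on (\<lambda>a. \<lambda>j\<in>A. (y j + int a * h j) mod M) A" by (rule inj_on_affine[OF A M h])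
      fix z :: "(nat \<Rightarrow> int) \<Rightarrow> int"
      have "(\<Sum>g\<in>?I. (z(h := z h + int a)) g * g j) = (\<Sum>g\<in>?I. z g * g j) + int a * h j" for a j
        using fin h by (simp add: sum.remove[of ?I h] algebra_simps)
      then show "\<pi> (z(h := z h + int a)) = (\<lambda>j\<in>A. (y j + int a * h j) mod M)
          \<longleftrightarrow> \<pi> z = (\<lambda>j\<in>A. y j mod M)" for a
        by (simp add: \<pi>_def restrict_mod_eq_iff cong_add_rcancel)
      have "(\<lambda>a. z(h := z h + int a)) ` A = (\<lambda>b. z(h := b)) ` ((+) (z h) ` int ` A)"
        by (simp add: image_image)
      then show "(\<lambda>a. z(h := z h + int a)) ` A \<in> pow_tiles (translates UNIV (int ` A)) ?I"
        using h unfolding pow_tiles_def translates_def by blast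
    qed
  qed
qed

lemma tileable_PiE_meeting:
  fixes C :: "'a set" and I :: "'i set"
  assumes "C \<subseteq> Y"
  shows "tileable (pow_tiles {C} I) {f \<in> I \<rightarrow>\<^sub>E Y. \<exists>i\<in>I. f i \<in> C}"
    (is "tileable _ ?X")
proof -
  define hits where "hits f = {i \<in> I. f i \<in> C}" for f :: "'i \<Rightarrow> 'a"
  define dir where "dir f = (SOME i. i \<in> hits f)" for f
  have dir: "dir f \<in> hits f" if "\<exists>i\<in>I. f i \<in> C" for f
    using that some_in_eq[of "hits f"] by (auto simp: dir_def hits_def)
  show ?thesis
  proof (rule tileable_lines[where dir = dir])
    fix f assume f: "f \<in> ?X"
    then have i: "dir f \<in> I" "f (dir f) \<in> C" using dir[of f] by (auto simp: hits_def)
    then show "dir f \<in> I" by simp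
    have "f(dir f := b) \<in> ?X \<and> dir (f(dir f := b)) = dir f \<longleftrightarrow> b \<in> C"
      (is "?L \<longleftrightarrow> _") for b
    proof
      assume ?L
      then show "b \<in> C" using dir[of "f(dir f := b)"] by (auto simp: hits_def)
    next
      assume b: "b \<in> C"
      then have "hits (f(dir f := b)) = hits f" using i by (auto simp: hits_def)
      then have "dir (f(dir f := b)) = dir f" by (simp add: dir_def)
      then show ?L using b f i assms by (auto simp: PiE_iff extensional_def)
    qed
    then show "tileable {C} {b. f(dir f := b) \<in> ?X \<and> dir (f(dir f := b)) = dir f}"
      by (simp add: tileable_tile)
  qed
qed

lemma axis_line_in_affine_tiles:
  assumes A: "A \<subseteq> {..D}" and M: "int D < M" "M > 1" and j: "j \<in> A"
    and line: "(\<lambda>b. f(j := b)) ` int ` A \<subseteq> A \<rightarrow>\<^sub>E {0..<M}"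
  shows "(\<lambda>b. f(j := b)) ` int ` A \<in> affine_tiles A M"
proof -
  define h where "h = (\<lambda>i\<in>A. if i = j then 1 else 0 :: int)"
  have "h \<in> directions A M" using M(2) j by (auto simp: directions_def h_def)
  moreover have "(\<lambda>i\<in>A. ((f(j := 0)) i + int a * h i) mod M) = f(j := int a)" if a: "a \<in> A" for a
  proof
    fix i
    have fa: "f(j := int a) \<in> A \<rightarrow>\<^sub>E {0..<M}" using line a by blast
    have "int a < M" using a A M(1) by force
    then show "(\<lambda>i\<in>A. ((f(j := 0)) i + int a * h i) mod M) i = (f(j := int a)) i"
      using PiE_mem[OF fa, of i] PiE_arb[OF fa, of i] j by (auto simp: h_def)
  qed
  then have "(\<lambda>b. f(j := b)) ` int ` A = affine_tile A M (f(j := 0)) h"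
    unfolding affine_tile_def image_image by (intro image_cong) simp_all
  ultimately show ?thesis unfolding affine_tiles_def by blast
qed

lemma tileable_affine_core:
  assumes A: "A \<subseteq> {..D}" and M: "int D < M" "M > 1"
  shows "tileable (affine_tiles A M) (affine_core A M)"
proof -
  have "int ` A \<subseteq> {0..<M}" using A M(1) by force
  then have "tileable (pow_tiles {int ` A} A) (affine_core A M)"
    unfolding affine_core_def by (rule tileable_PiE_meeting)
  then have "tileable (affine_tiles A M) (id ` affine_core A M)"
  proof (rule tileable_image)
    fix B assume "B \<in> pow_tiles {int ` A} A" "B \<subseteq> affine_core A M"
    then have "B \<in> affine_tiles A M"
      by (elim pow_tilesE) (auto simp: affine_core_def intro!: axis_line_in_affine_tiles[OF A M])
    then show "tileable (affine_tiles A M) (id ` B)" by (simp add: tileable_tile)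
  qed simp
  then show ?thesis by simp
qed

lemma ex_affine_root:
  fixes M :: int
  assumes "prime M" "\<not> M dvd a"
  shows "\<exists>x\<in>{0..<M}. (y + a * x) mod M = 0"
proof -
  have "coprime a M" using assms by (simp add: coprime_commute prime_imp_coprime)
  then obtain r where r: "[a * r = 1] (mod M)" using cong_solve_coprime_int by blast
  define x where "x = (- y * r) mod M"
  have "[y + a * x = y + a * (- y * r)] (mod M)"
    by (intro cong_add cong_scalar_left cong_refl) (simp add: x_def)
  also have "y + a * (- y * r) = y + - y * (a * r)" by simp
  also have "[y + - y * (a * r) = y + - y * 1] (mod M)"
    using r by (intro cong_add cong_scalar_left cong_refl)
  finally have "(y + a * x) mod M = 0" by (simp add: cong_0_iff)
  moreover have "x \<in> {0..<M}" using prime_gt_0_int[OF assms(1)] by (simp add: x_def)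
  ultimately show ?thesis by (rule bexI)
qed

lemma ex_affine_tile_into_core:
  assumes A: "A \<subseteq> {..D}" "0 \<in> A" and M: "prime M" "int D < M" and v: "v \<in> A \<rightarrow>\<^sub>E {0..<M}"
  shows "\<exists>C\<in>affine_tiles A M. v \<in> C \<and> C - {v} \<subseteq> affine_core A M"
proof -
  have M_gt: "M > 1" using M(1) by (rule prime_gt_1_int)
  have "\<exists>x\<in>{0..<M}. (v j + int j * x) mod M = 0" if j: "j \<in> A - {0}" for j
  proof (rule ex_affine_root[OF M(1)])
    show "\<not> M dvd int j" using j A(1) M(2) by (force dest: zdvd_imp_le)
  qed
  then obtain s where s: "\<And>j. j \<in> A - {0} \<Longrightarrow> s j \<in> {0..<M} \<and> (v j + int j * s j) mod M = 0"
    by metis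
  define h where "h = (\<lambda>j\<in>A. if j = 0 then 1 else s j)"
  have h: "h \<in> directions A M" using s A(2) M_gt by (auto simp: directions_def h_def)
  let ?w = "\<lambda>a. \<lambda>j\<in>A. (v j + int a * h j) mod M"
  have w0: "?w 0 = v"
    using v by (auto simp: fun_eq_iff PiE_iff extensional_def)
  have "?w a \<in> affine_core A M" if "a \<in> A" "a \<noteq> 0" for a
  proof -
    have "?w a a = int 0" using s[of a] that by (simp add: h_def)
    then show ?thesis using that A(2) M_gt unfolding affine_core_def by fastforce
  qed
  moreover have "a \<noteq> 0" if "?w a \<noteq> v" for a using that w0 by metis
  ultimately have "affine_tile A M v h - {v} \<subseteq> affine_core A M"
    unfolding affine_tile_def by blast
  moreover have "v \<in> affine_tile A M v h"
    unfolding affine_tile_def by (rule image_eqI[where x = 0]) (use w0 A(2) in auto)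
  moreover have "affine_tile A M v h \<in> affine_tiles A M"
    using h unfolding affine_tiles_def by blast
  ultimately show ?thesis by blast
qed

section \<open>From sets of integers to tiles\<close>

lemma translates_translate:
  fixes A :: "'a::group_add set"
  shows "translates UNIV ((+) u ` A) = translates UNIV A"
proof (intro equalityI subsetI)
  fix B assume "B \<in> translates UNIV ((+) u ` A)"
  then obtain x where "B = (+) (x + u) ` A"
    unfolding translates_def by (auto simp: image_image add.assoc)
  then show "B \<in> translates UNIV A" unfolding translates_def by blast
next
  fix B assume "B \<in> translates UNIV A"
  then obtain x where "B = (+) x ` A" unfolding translates_def by blast
  then have "B = (+) (x - u) ` (+) u ` A" by (simp add: image_image add.assoc[symmetric])
  then show "B \<in> translates UNIV ((+) u ` A)" unfolding translates_def by blast
qed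

lemma ex_tileable_affine_product:
  assumes A: "A \<subseteq> {..D}" "0 \<in> A" and M: "prime M" "int D < M"
  shows "\<exists>N>int D. \<exists>(d::nat) (m::nat). tileable
    (prod_tiles (prod_tiles (cyclic_tiles A N) (cyclic_tiles A N))
      (pow_tiles (prod_tiles (affine_tiles A M) (pow_tiles (cyclic_tiles A N) {..<d})) {..<m}))
    (({0..<N} \<times> {0..<N}) \<times> ({..<m} \<rightarrow>\<^sub>E (A \<rightarrow>\<^sub>E {0..<M}) \<times> ({..<d} \<rightarrow>\<^sub>E {0..<N})))"
proof -
  obtain N c s where N: "int D < N"
    and cover_Suc: "multicover (cyclic_tiles A N) {0..<N} (\<lambda>x. Suc (card A * c x)) s"
    using ex_cyclic_multicover[OF A] by blast
  have cover_card: "multicover (cyclic_tiles A N) {0..<N} (\<lambda>_. card A) (nat N)"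
    using multicover_cyclic[OF A(1) N, of "\<lambda>_. 1"] by simp
  have "\<exists>C\<in>cyclic_tiles A N. x \<in> C \<and> C \<subseteq> {0..<N}" if "x \<in> {0..<N}" for x
  proof (rule bexI[of _ "cyclic_tile A N x"])
    show "x \<in> cyclic_tile A N x \<and> cyclic_tile A N x \<subseteq> {0..<N}"
      using that A(2) N unfolding cyclic_tile_def by (force intro!: image_eqI[of x _ 0])
  qed (simp add: cyclic_tiles_def)
  moreover have "finite (A \<rightarrow>\<^sub>E {0..<M})"
    using finite_subset[OF A(1)] by (intro finite_PiE) auto
  moreover have "affine_core A M \<subseteq> A \<rightarrow>\<^sub>E {0..<M}" by (auto simp: affine_core_def)
  moreover have "tileable (affine_tiles A M) (affine_core A M)"
    using A(1) M(2) prime_gt_1_int[OF M(1)] by (rule tileable_affine_core)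
  moreover have "\<exists>C\<in>affine_tiles A M. v \<in> C \<and> C - {v} \<subseteq> affine_core A M"
    if "v \<in> (A \<rightarrow>\<^sub>E {0..<M}) - affine_core A M" for v
    using ex_affine_tile_into_core[OF A M] that by blast
  ultimately show ?thesis
    using ex_tileable_product[OF _ cover_Suc cover_card, of "A \<rightarrow>\<^sub>E {0..<M}" "affine_core A M"] N
    by blast
qed

lemma ex_tileable_power_translates_nat:
  assumes A: "finite A" "0 \<in> A"
  shows "\<exists>J::nat>0. tileable (pow_tiles (translates UNIV (int ` A)) {..<J}) ({..<J} \<rightarrow>\<^sub>E UNIV)"
proof -
  let ?Z = "translates UNIV (int ` A)"
  define D where "D = Max A"
  have D: "A \<subseteq> {..D}" using A(1) by (auto simp: D_def)
  obtain q where q: "prime q" "q > D" using bigger_prime by blast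
  define M where "M = int q"
  have M: "prime M" "int D < M" using q by (simp_all add: M_def)
  obtain N and d m :: nat where N: "int D < N" and tiling: "tileable
    (prod_tiles (prod_tiles (cyclic_tiles A N) (cyclic_tiles A N))
      (pow_tiles (prod_tiles (affine_tiles A M) (pow_tiles (cyclic_tiles A N) {..<d})) {..<m}))
    (({0..<N} \<times> {0..<N}) \<times> ({..<m} \<rightarrow>\<^sub>E (A \<rightarrow>\<^sub>E {0..<M}) \<times> ({..<d} \<rightarrow>\<^sub>E {0..<N})))"
    using ex_tileable_affine_product[OF D A(2) M] by blast
  define I where "I = ({()} <+> {()}) <+> ({..<m} \<times> (directions A M <+> ({..<d} \<times> {()})))"
  have cyclic: "tiling_quotient ({()} \<rightarrow>\<^sub>E UNIV) (pow_tiles ?Z {()}) {0..<N} (cyclic_tiles A N)"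
    using tiling_quotient_trans[OF tiling_quotient_power_singleton tiling_quotient_cyclic[OF D N]] .
  have "tileable (pow_tiles ?Z I) (I \<rightarrow>\<^sub>E UNIV)"
    using tiling unfolding I_def
    by (elim tileable_if_tiling_quotient[rotated])
      (intro tiling_quotient_power_prod tiling_quotient_power_pow cyclic tiling_quotient_affine[OF D M])
  moreover have "finite I"
    using A(1) by (simp add: I_def finite_directions)
  then obtain e where e: "bij_betw e I {..<card I}"
    using ex_bij_betw_finite_nat by (metis atLeast0LessThan)
  ultimately have "tileable (pow_tiles ?Z {..<card I}) ({..<card I} \<rightarrow>\<^sub>E UNIV)"
    by (intro tileable_if_tiling_quotient[OF tiling_quotient_power_reindex[OF e]])
  moreover have "card I > 0"
    using \<open>finite I\<close> by (auto simp: I_def card_gt_0_iff)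
  ultimately show ?thesis by blast
qed

lemma ex_tileable_power_translates:
  fixes A :: "int set"
  assumes "finite A" "A \<noteq> {}"
  shows "\<exists>J::nat>0. tileable (pow_tiles (translates UNIV A) {..<J}) ({..<J} \<rightarrow>\<^sub>E UNIV)"
proof -
  define A' where "A' = (\<lambda>a. nat (a - Min A)) ` A"
  have "int ` A' = (+) (- Min A) ` A"
    using assms(1) unfolding A'_def image_image by (intro image_cong) auto
  then have "translates UNIV (int ` A') = translates UNIV A"
    by (simp only: translates_translate)
  moreover have "finite A'" using assms(1) by (simp add: A'_def)
  moreover have "0 \<in> A'"
    unfolding A'_def by (rule image_eqI[OF _ Min_in[OF assms]]) simp
  ultimately show ?thesis using ex_tileable_power_translates_nat[of A'] by simp
qed

lemma ex_linear_form_nonzero: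
  fixes X :: "(nat \<Rightarrow> int) set"
  assumes "finite X" "\<And>x. x \<in> X \<Longrightarrow> \<exists>i<n. x i \<noteq> 0"
  shows "\<exists>c. \<forall>x\<in>X. (\<Sum>i<n. c i * x i) \<noteq> 0"
  using assms
proof (induction n arbitrary: X)
  case (Suc n)
  define X' where "X' = {x \<in> X. \<exists>i<n. x i \<noteq> 0}"
  have "\<exists>c. \<forall>x\<in>X'. (\<Sum>i<n. c i * x i) \<noteq> 0"
    using Suc.prems(1) by (intro Suc.IH) (auto simp: X'_def)
  then obtain c where c: "\<And>x. x \<in> X' \<Longrightarrow> (\<Sum>i<n. c i * x i) \<noteq> 0" by blast
  define \<phi> where "\<phi> x = (\<Sum>i<n. c i * x i)" for x
  define K where "K = 1 + (\<Sum>x\<in>X. \<bar>\<phi> x\<bar>)"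
  have "\<phi> x + K * x n \<noteq> 0" if x: "x \<in> X" for x
  proof (cases "x n = 0")
    case True
    then have "x \<in> X'" using Suc.prems(2)[OF x] x by (auto simp: X'_def less_Suc_eq)
    then show ?thesis using c True by (simp add: \<phi>_def)
  next
    case False
    have "\<bar>\<phi> x\<bar> < K"
      using member_le_sum[of x X "\<lambda>x. \<bar>\<phi> x\<bar>"] Suc.prems(1) x by (simp add: K_def)
    moreover have "K * 1 \<le> K * \<bar>x n\<bar>"
      using False by (intro mult_left_mono) (auto simp: K_def sum_nonneg)
    moreover have "K * \<bar>x n\<bar> = \<bar>K * x n\<bar>"
      by (simp add: abs_mult K_def sum_nonneg)
    ultimately show ?thesis by linarith
  qed
  then have "\<forall>x\<in>X. (\<Sum>i<Suc n. (c(n := K)) i * x i) \<noteq> 0" by (simp add: \<phi>_def)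
  then show ?case by blast
qed auto

lemma ex_additive_inj_on:
  fixes T :: "(nat \<Rightarrow> int) set"
  assumes T: "finite T" "T \<subseteq> zspace n"
  shows "\<exists>\<phi> :: (nat \<Rightarrow> int) \<Rightarrow> int. (\<forall>x y. \<phi> (x + y) = \<phi> x + \<phi> y) \<and> inj_on \<phi> T"
proof -
  define X where "X = (\<lambda>(t, t'). t - t') ` (T \<times> T) - {0}"
  have "\<exists>i<n. x i \<noteq> 0" if "x \<in> X" for x
  proof (rule ccontr)
    assume low: "\<not> (\<exists>i<n. x i \<noteq> 0)"
    obtain t t' where "x = t - t'" "t \<in> T" "t' \<in> T"
      using \<open>x \<in> X\<close> by (auto simp: X_def)
    moreover from this have "t \<in> zspace n" "t' \<in> zspace n" using T(2) by auto
    ultimately have "x i = 0" for i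
      using low by (cases "i < n") (auto simp: zspace_def)
    then show False using that by (auto simp: X_def fun_eq_iff)
  qed
  then obtain c where c: "\<And>x. x \<in> X \<Longrightarrow> (\<Sum>i<n. c i * x i) \<noteq> 0"
    using ex_linear_form_nonzero[of X n] T(1) by (auto simp: X_def)
  define \<phi> where "\<phi> x = (\<Sum>i<n. c i * x i)" for x
  have \<phi>_add: "\<phi> (x + y) = \<phi> x + \<phi> y" for x y
    by (simp add: \<phi>_def distrib_left sum.distrib)
  have "inj_on \<phi> T"
  proof (rule inj_onI, rule ccontr)
    fix t t' assume t: "t \<in> T" "t' \<in> T" "\<phi> t = \<phi> t'" "t \<noteq> t'"
    then have "\<phi> (t - t') = 0" using \<phi>_add[of "t - t'" t'] by simp
    moreover have "t - t' \<in> X" using t by (auto simp: X_def)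
    ultimately show False using c unfolding \<phi>_def by blast
  qed
  then show ?thesis using \<phi>_add by blast
qed

lemma tiles_if_tileable:
  assumes "tileable {S. is_copy d T S} (zspace d)"
  shows "tiles T d"
  using assms unfolding tileable_def partition_on_def tiles_def disjoint_def by auto

definition glue_blocks :: "nat \<Rightarrow> nat \<Rightarrow> (nat \<Rightarrow> nat \<Rightarrow> int) \<Rightarrow> nat \<Rightarrow> int" where
  "glue_blocks J n g = (\<lambda>l. if l < J * n then g (l div n) (l mod n) else 0)"

lemma bij_betw_glue_blocks:
  assumes "n > 0"
  shows "bij_betw (glue_blocks J n) ({..<J} \<rightarrow>\<^sub>E zspace n) (zspace (J * n))"
proof (rule bij_betw_byWitness[where f' = "\<lambda>z. \<lambda>j\<in>{..<J}. \<lambda>i. if i < n then z (j * n + i) else 0"])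
  have less: "j * n + i < J * n" if "j < J" "i < n" for i j
  proof -
    have "j * n + i < Suc j * n" using that(2) by simp
    also have "\<dots> \<le> J * n" using that(1) by (intro mult_le_mono1) simp
    finally show ?thesis .
  qed
  show "\<forall>g\<in>{..<J} \<rightarrow>\<^sub>E zspace n.
      (\<lambda>j\<in>{..<J}. \<lambda>i. if i < n then glue_blocks J n g (j * n + i) else 0) = g"
    using less by (auto simp: fun_eq_iff glue_blocks_def zspace_def PiE_iff extensional_def)
  show "\<forall>z\<in>zspace (J * n).
      glue_blocks J n (\<lambda>j\<in>{..<J}. \<lambda>i. if i < n then z (j * n + i) else 0) = z"
    using assms by (auto simp: fun_eq_iff glue_blocks_def zspace_def less_mult_imp_div_less)
qed (auto simp: glue_blocks_def zspace_def)

lemma edist_glue_blocks: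
  assumes "n > 0" "j < J" "t \<in> zspace n" "t' \<in> zspace n"
  shows "edist (J * n) (glue_blocks J n (g(j := u + t))) (glue_blocks J n (g(j := u + t')))
    = edist (J * n) t t'"
proof -
  let ?diff = "\<lambda>l. glue_blocks J n (g(j := u + t)) l - glue_blocks J n (g(j := u + t')) l"
  have le: "j * n + n \<le> J * n"
    using mult_le_mono1[of "Suc j" J n] assms(2) by simp
  have block: "l div n = j \<longleftrightarrow> l \<in> {j * n..<j * n + n}" for l
    using assms(1) dividend_less_times_div[of n l] by (auto simp: ac_simps intro!: div_nat_eqI)
  have diff_outside: "?diff l = 0" if "l \<notin> {j * n..<j * n + n}" for l
    using that unfolding block[symmetric] by (simp add: glue_blocks_def)
  have diff_inside: "?diff l = t (l - j * n) - t' (l - j * n)" if l: "l \<in> {j * n..<j * n + n}" for l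
  proof -
    have "l div n = j" using l by (simp only: block)
    moreover from this have "l mod n = l - j * n" by (metis minus_div_mult_eq_mod)
    ultimately show ?thesis using l le by (simp add: glue_blocks_def)
  qed
  have "(\<Sum>l<J * n. (real_of_int (?diff l))\<^sup>2)
      = (\<Sum>l\<in>{j * n..<j * n + n}. (real_of_int (t (l - j * n) - t' (l - j * n)))\<^sup>2)"
    by (rule sum.mono_neutral_cong_right) (use le diff_outside diff_inside in auto)
  also have "\<dots> = (\<Sum>i<n. (real_of_int (t i - t' i))\<^sup>2)"
    by (rule sum.reindex_bij_witness[of _ "\<lambda>i. j * n + i" "\<lambda>l. l - j * n"]) auto
  also have "\<dots> = (\<Sum>i<J * n. (real_of_int (t i - t' i))\<^sup>2)"
    using assms(2-4) le by (intro sum.mono_neutral_left) (auto simp: zspace_def)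
  finally show ?thesis by (simp add: edist_def)
qed

lemma tiling_quotient_glue_blocks:
  assumes n: "n > 0" and T: "T \<subseteq> zspace n"
  shows "tiling_quotient (zspace (J * n)) {S. is_copy (J * n) T S}
    ({..<J} \<rightarrow>\<^sub>E zspace n) (pow_tiles (translates (zspace n) T) {..<J})"
proof (rule tiling_quotient_bij[OF bij_betw_glue_blocks[OF n]])
  fix B assume B: "B \<in> pow_tiles (translates (zspace n) T) {..<J}" "B \<subseteq> {..<J} \<rightarrow>\<^sub>E zspace n"
  then obtain g j u where j: "j < J" and B_eq: "B = (\<lambda>t. g(j := u + t)) ` T"
    by (auto simp: translates_def image_image elim!: pow_tilesE)
  have "inj_on (\<lambda>t. g(j := u + t)) T"
    by (rule inj_onI) (metis add_left_cancel fun_upd_eqD)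
  then have "inj_on (glue_blocks J n \<circ> (\<lambda>t. g(j := u + t))) T"
    using bij_betw_imp_inj_on[OF bij_betw_glue_blocks[OF n]] B(2)
    unfolding B_eq by (intro comp_inj_on) (auto intro: inj_on_subset)
  then have "bij_betw (\<lambda>t. glue_blocks J n (g(j := u + t))) T (glue_blocks J n ` B)"
    unfolding B_eq by (simp add: bij_betw_def image_image o_def)
  moreover have "glue_blocks J n ` B \<subseteq> zspace (J * n)"
    by (auto simp: glue_blocks_def zspace_def)
  moreover have "\<forall>t\<in>T. \<forall>t'\<in>T.
      edist (J * n) (glue_blocks J n (g(j := u + t))) (glue_blocks J n (g(j := u + t')))
        = edist (J * n) t t'"
    using edist_glue_blocks[OF n j] T by blast
  ultimately have "is_copy (J * n) T (glue_blocks J n ` B)"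
    unfolding is_copy_def by blast
  then show "glue_blocks J n ` B \<in> {S. is_copy (J * n) T S}" by simp
qed

theorem theorem1:
  fixes n :: nat and T :: "(nat \<Rightarrow> int) set"
  assumes "n \<ge> 1" and "is_tile n T"
  shows "\<exists>d\<ge>n. tiles T d"
proof -
  have T: "finite T" "T \<noteq> {}" "T \<subseteq> zspace n"
    using assms(2) by (auto simp: is_tile_def)
  obtain \<phi> :: "(nat \<Rightarrow> int) \<Rightarrow> int" where \<phi>: "\<And>x y. \<phi> (x + y) = \<phi> x + \<phi> y" "inj_on \<phi> T"
    using ex_additive_inj_on[OF T(1,3)] by blast
  obtain J :: nat where J: "J > 0"
    "tileable (pow_tiles (translates UNIV (\<phi> ` T)) {..<J}) ({..<J} \<rightarrow>\<^sub>E UNIV)"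
    using ex_tileable_power_translates[of "\<phi> ` T"] T(1,2) by blast
  have "tiling_quotient (zspace n) (translates (zspace n) T) UNIV (translates UNIV (\<phi> ` T))"
    using T(3) by (intro tiling_quotient_additive \<phi>) (auto simp: zspace_def)
  from tiling_quotient_trans[OF tiling_quotient_glue_blocks tiling_quotient_pow[OF this]]
  have "tileable {S. is_copy (J * n) T S} (zspace (J * n))"
    using assms(1) T(3) J(2) by (auto intro: tileable_if_tiling_quotient)
  then have "tiles T (J * n)" by (rule tiles_if_tileable)
  moreover have "J * n \<ge> n" using J(1) by simp
  ultimately show ?thesis by blast
qed

end
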